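(* Let $\mathbb{K}$ be a field of characteristic zero and let $A,B\in\mathfrak{lie}_2$ be Lie series in two variables $x,y$ satisfying $$(1-\exp(-\mathrm{ad}_x))A(x,y)+(\exp(\mathrm{ad}_y)-1)B(x,y)=x+y-\mathrm{ch}(y,x).$$ Then, in $\mathfrak{tr}_2^{quad}$, $$\mathrm{tr}^{quad}\big(x(\partial_x A)+y(\partial_y B)\big)=\frac12\,\mathrm{tr}^{quad}\big(f(x)+f(y)-f(\mathrm{ch}(x,y))\big),$$ where $f(x)=\frac{x}{e^x-1}-1+\frac{x}{2}=\sum_{k\ge 2}B_k\frac{x^k}{k!}$ ($B_k$ the Bernoulli numbers).
   Context: $\mathbb{K}$ is a field of characteristic zero. $\mathfrak{lie}_n$ is the degree completion of the free Lie algebra over $\mathbb{K}$ on $n$ generators $x_1,\dots,x_n$ (for $n=2$ the generators are written $x,y$). $\mathrm{Ass}_n=U(\mathfrak{lie}_n)$ is the degree completion of the free associative unital algebra on the same generators (noncommutative formal power series), and $\mathfrak{lie}_n\subset\mathrm{Ass}_n$. The Campbell-Hausdorff series is $\mathrm{ch}(x,y)=\ln(e^xe^y)\in\mathfrak{lie}_2$; thus $\mathrm{ch}(y,x)=\ln(e^ye^x)$. As usual $\mathrm{ad}_x(z)=[x,z]$. Every $\alpha\in\mathrm{Ass}_n$ has a unique decomposition $\alpha=\alpha_0+\sum_{i=1}^n(\partial_i\alpha)x_i$ with $\alpha_0\in\mathbb{K}$ and $\partial_i\alpha\in\mathrm{Ass}_n$; for $n=2$ one writes $\partial_x,\partial_y$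 for $\partial_1,\partial_2$. $C_n\subset\mathrm{Ass}_n$ is the subspace spanned by all commutators $ab-ba$, $a,b\in\mathrm{Ass}_n$. $\tau$ is the unique anti-involution of $\mathrm{Ass}_n$ (so $\tau(ab)=\tau(b)\tau(a)$) with $\tau(\alpha)=-\alpha$ for all $\alpha\in\mathfrak{lie}_n$, and $A_n=\{\alpha\in\mathrm{Ass}_n:\tau(\alpha)=-\alpha\}$. Set $\mathfrak{tr}_n^{quad}=\mathrm{Ass}_n/\langle A_n,C_n\rangle$, where $\langle A_n,C_n\rangle$ is the span of $A_n$ and $C_n$, and let $\mathrm{tr}^{quad}:\mathrm{Ass}_n\to\mathfrak{tr}_n^{quad}$ be the projection. For a power series $f$ and $z\in\mathfrak{lie}_n$, $f(z)$ is understood as an element of $\mathrm{Ass}_n$. *)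

theory Defs
  imports "HOL-Computational_Algebra.Formal_Power_Series"
begin

section \<open>The completed free associative algebra\<close>

text \<open>
  Formal power series in noncommuting variables indexed by \<open>'v\<close>: a word is a list of
  variables, and a series is an arbitrary family of coefficients indexed by words.
  For \<open>'v\<close> finite with \<open>n\<close> elements this is the degree completion \<open>Ass\<^sub>n\<close>.
\<close>

typedef ('v, 'k) ncfps = "UNIV :: ('v list \<Rightarrow> 'k) set"
  morphisms nc_coeff Abs_ncfps ..

setup_lifting type_definition_ncfps

lemma ncfps_eq_iff: "a = b \<longleftrightarrow> (\<forall>w. nc_coeff a w = nc_coeff b w)"
  by (auto simp: nc_coeff_inject[symmetric])

lemma ncfps_eqI: "(\<And>w. nc_coeff a w = nc_coeff b w) \<Longrightarrow> a = b"
  by (simp add: ncfps_eq_iff)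

instantiation ncfps :: (type, ab_group_add) ab_group_add
begin

lift_definition zero_ncfps :: "('a, 'b) ncfps" is "\<lambda>_. 0" .
lift_definition plus_ncfps :: "('a, 'b) ncfps \<Rightarrow> ('a, 'b) ncfps \<Rightarrow> ('a, 'b) ncfps"
  is "\<lambda>a b w. a w + b w" .
lift_definition minus_ncfps :: "('a, 'b) ncfps \<Rightarrow> ('a, 'b) ncfps \<Rightarrow> ('a, 'b) ncfps"
  is "\<lambda>a b w. a w - b w" .
lift_definition uminus_ncfps :: "('a, 'b) ncfps \<Rightarrow> ('a, 'b) ncfps"
  is "\<lambda>a w. - a w" .

instance
  by standard (transfer; simp add: algebra_simps fun_eq_iff)+

end

lemmas nc_coeff_linear [simp] =
  zero_ncfps.rep_eq plus_ncfps.rep_eq minus_ncfps.rep_eq uminus_ncfps.rep_eq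

instantiation ncfps :: (type, ring_1) ring_1
begin

lift_definition one_ncfps :: "('a, 'b) ncfps" is "\<lambda>w. if w = [] then 1 else 0" .

text \<open>The sum runs over all factorisations \<open>w = u @ v\<close> of the word \<open>w\<close>.\<close>

lift_definition times_ncfps :: "('a, 'b) ncfps \<Rightarrow> ('a, 'b) ncfps \<Rightarrow> ('a, 'b) ncfps"
  is "\<lambda>a b w. \<Sum>i\<le>length w. a (take i w) * b (drop i w)" .

instance
proof
  fix a b c :: "('a, 'b) ncfps"
  show "a * b * c = a * (b * c)"
  proof (transfer, rule ext)
    fix a b c :: "'a list \<Rightarrow> 'b" and w :: "'a list"
    let ?n = "length w"
    have "(\<Sum>i\<le>?n. (\<Sum>j\<le>length (take i w). a (take j (take i w)) * b (drop j (take i w))) * c (drop i w))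
        = (\<Sum>i\<le>?n. \<Sum>j\<le>i. a (take j w) * b (drop j (take i w)) * c (drop i w))"
      by (intro sum.cong refl) (auto simp: sum_distrib_right min_def intro!: sum.cong)
    also have "\<dots> = (\<Sum>(i,j)\<in>(SIGMA i:{..?n}. {..i}). a (take j w) * b (drop j (take i w)) * c (drop i w))"
      by (simp add: sum.Sigma)
    also have "\<dots> = (\<Sum>(j,k)\<in>(SIGMA j:{..?n}. {..?n-j}). a (take j w) * (b (take k (drop j w)) * c (drop k (drop j w))))"
      by (rule sum.reindex_bij_witness[where i = "\<lambda>(j,k). (j+k,j)" and j = "\<lambda>(i,j). (j,i-j)"])
         (auto simp: take_drop mult.assoc add.commute)
    also have "\<dots> = (\<Sum>j\<le>?n. a (take j w) * (\<Sum>k\<le>length (drop j w). b (take k (drop j w)) * c (drop k (drop j w))))"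
      by (simp add: sum.Sigma sum_distrib_left)
    finally show "(\<Sum>i\<le>?n. (\<Sum>j\<le>length (take i w). a (take j (take i w)) * b (drop j (take i w))) * c (drop i w)) = \<dots>" .
  qed
  show "1 * a = a"
  proof (transfer, rule ext)
    fix a :: "'a list \<Rightarrow> 'b" and w :: "'a list"
    have "(\<Sum>i\<le>length w. (if take i w = [] then 1 else 0) * a (drop i w))
        = (\<Sum>i\<le>length w. if i = 0 then a w else 0)"
      by (intro sum.cong refl) auto
    then show "(\<Sum>i\<le>length w. (if take i w = [] then 1 else 0) * a (drop i w)) = a w"
      by simp
  qed
  show "a * 1 = a"
  proof (transfer, rule ext)
    fix a :: "'a list \<Rightarrow> 'b" and w :: "'a list"
    have "(\<Sum>i\<le>length w. a (take i w) * (if drop i w = [] then 1 else 0))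
        = (\<Sum>i\<le>length w. if i = length w then a w else 0)"
      by (intro sum.cong refl) auto
    then show "(\<Sum>i\<le>length w. a (take i w) * (if drop i w = [] then 1 else 0)) = a w"
      by simp
  qed
  show "(a + b) * c = a * c + b * c"
    by (transfer; simp add: distrib_right sum.distrib)
  show "a * (b + c) = a * b + a * c"
    by (transfer; simp add: distrib_left sum.distrib)
  show "(0 :: ('a, 'b) ncfps) \<noteq> 1"
    by (transfer; simp add: fun_eq_iff)
qed

end

lemma nc_coeff_one: "nc_coeff 1 w = (if w = [] then 1 else 0)"
  by (simp add: one_ncfps.rep_eq)

lemma nc_coeff_mult:
  "nc_coeff (a * b) w = (\<Sum>i\<le>length w. nc_coeff a (take i w) * nc_coeff b (drop i w))"
  by (simp add: times_ncfps.rep_eq)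

lift_definition nc_scale :: "'k::times \<Rightarrow> ('v, 'k) ncfps \<Rightarrow> ('v, 'k) ncfps"
  is "\<lambda>c a w. c * a w" .

declare nc_scale.rep_eq [simp]

global_interpretation nc: vector_space "nc_scale :: 'k::field \<Rightarrow> ('v, 'k) ncfps \<Rightarrow> ('v, 'k) ncfps"
  by standard (auto simp: ncfps_eq_iff algebra_simps)

lift_definition nc_var :: "'v \<Rightarrow> ('v, 'k::zero_neq_one) ncfps"
  is "\<lambda>i w. if w = [i] then 1 else 0" .

lift_definition nc_hom_part :: "nat \<Rightarrow> ('v, 'k::zero) ncfps \<Rightarrow> ('v, 'k) ncfps"
  is "\<lambda>d a w. if length w = d then a w else 0" .

definition nc_commutator :: "('v, 'k::ring_1) ncfps \<Rightarrow> ('v, 'k) ncfps \<Rightarrow> ('v, 'k) ncfps"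
  where "nc_commutator a b = a * b - b * a"


section \<open>The completed free Lie algebra\<close>

text \<open>
  The Lie subalgebra of the free associative algebra generated by the variables is the free Lie
  algebra.  It is graded, and its degree completion consists of the series all of whose
  homogeneous components are Lie polynomials.
\<close>

inductive_set lie_poly :: "('v, 'k::field) ncfps set" where
  var: "nc_var i \<in> lie_poly"
| zero: "0 \<in> lie_poly"
| add: "a \<in> lie_poly \<Longrightarrow> b \<in> lie_poly \<Longrightarrow> a + b \<in> lie_poly"
| scale: "a \<in> lie_poly \<Longrightarrow> nc_scale c a \<in> lie_poly"
| bracket: "a \<in> lie_poly \<Longrightarrow> b \<in> lie_poly \<Longrightarrow> nc_commutator a b \<in> lie_poly"

definition lie :: "('v, 'k::field) ncfps set"
  where "lie = {a. \<forall>d. nc_hom_part d a \<in> lie_poly}"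


section \<open>Power series applied to elements and to operators\<close>

text \<open>
  \<open>nc_subst f z\<close> is \<open>f(z) = \<Sum>k. f\<^sub>k z\<^sup>k\<close>, for \<open>z\<close> without constant term.  Since then
  \<open>z\<^sup>k\<close> has no coefficients on words shorter than \<open>k\<close>, the infinite sum may be cut off at
  the length of the word under consideration.  For \<open>z\<close> with a constant term the value is
  meaningless.
\<close>

definition nc_subst :: "'k::field fps \<Rightarrow> ('v, 'k) ncfps \<Rightarrow> ('v, 'k) ncfps"
  where "nc_subst f z = Abs_ncfps (\<lambda>w. \<Sum>k\<le>length w. fps_nth f k * nc_coeff (z ^ k) w)"

lemma nc_coeff_subst:
  "nc_coeff (nc_subst f z) w = (\<Sum>k\<le>length w. fps_nth f k * nc_coeff (z ^ k) w)"
  by (simp add: nc_subst_def Abs_ncfps_inverse)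

lemma nc_coeff_power_eq_0:
  assumes "nc_coeff z [] = 0" and "length w < k"
  shows "nc_coeff (z ^ k) w = 0"
  using assms(2)
proof (induction k arbitrary: w)
  case (Suc k)
  have "nc_coeff z (take i w) * nc_coeff (z ^ k) (drop i w) = 0" if "i \<le> length w" for i
    using Suc that assms(1) by (cases "i = 0") auto
  then show ?case by (simp add: nc_coeff_mult)
qed simp

lemma nc_coeff_subst_upto:
  assumes "nc_coeff z [] = 0" and "length w \<le> n"
  shows "nc_coeff (nc_subst f z) w = (\<Sum>k\<le>n. fps_nth f k * nc_coeff (z ^ k) w)"
  unfolding nc_coeff_subst
  by (rule sum.mono_neutral_left) (use assms in \<open>auto simp: nc_coeff_power_eq_0\<close>)

definition nc_exp :: "('v, 'k::field_char_0) ncfps \<Rightarrow> ('v, 'k) ncfps"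
  where "nc_exp z = nc_subst (fps_exp 1) z"

text \<open>\<open>fps_ln 1\<close> is the expansion of \<open>ln(1 + t)\<close>; the argument must have constant term 1.\<close>

definition nc_ln :: "('v, 'k::field_char_0) ncfps \<Rightarrow> ('v, 'k) ncfps"
  where "nc_ln a = nc_subst (fps_ln 1) (a - 1)"

definition ch :: "('v, 'k::field_char_0) ncfps \<Rightarrow> ('v, 'k) ncfps \<Rightarrow> ('v, 'k) ncfps"
  where "ch a b = nc_ln (nc_exp a * nc_exp b)"

text \<open>
  Likewise, \<open>nc_op_exp T a\<close> is \<open>exp(T) a = \<Sum>k. T\<^sup>k a / k!\<close>, for a linear operator
  \<open>T\<close> that raises the order of every series (such as \<open>ad\<^sub>z\<close> for \<open>z\<close> without constant term).
\<close>


definition nc_op_exp ::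
  "(('v, 'k::field_char_0) ncfps \<Rightarrow> ('v, 'k) ncfps) \<Rightarrow> ('v, 'k) ncfps \<Rightarrow> ('v, 'k) ncfps"
  where "nc_op_exp T a = Abs_ncfps (\<lambda>w. \<Sum>k\<le>length w. nc_coeff ((T ^^ k) a) w / fact k)"

lemma nc_coeff_op_exp:
  "nc_coeff (nc_op_exp T a) w = (\<Sum>k\<le>length w. nc_coeff ((T ^^ k) a) w / fact k)"
  by (simp add: nc_op_exp_def Abs_ncfps_inverse)

definition nc_raises_order :: "(('v, 'k::zero) ncfps \<Rightarrow> ('v, 'k) ncfps) \<Rightarrow> bool"
  where "nc_raises_order T \<longleftrightarrow> (\<forall>b m.
    (\<forall>u. length u < m \<longrightarrow> nc_coeff b u = 0) \<longrightarrow> (\<forall>u. length u < Suc m \<longrightarrow> nc_coeff (T b) u = 0))"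

lemma nc_coeff_funpow_eq_0:
  assumes "nc_raises_order T" and "length w < k"
  shows "nc_coeff ((T ^^ k) a) w = 0"
  using assms(2)
proof (induction k arbitrary: w)
  case (Suc k)
  then have "\<forall>u. length u < Suc k \<longrightarrow> nc_coeff (T ((T ^^ k) a)) u = 0"
    using assms(1) unfolding nc_raises_order_def by blast
  with Suc.prems show ?case by simp
qed simp

lemma nc_coeff_op_exp_upto:
  assumes "nc_raises_order T" and "length w \<le> n"
  shows "nc_coeff (nc_op_exp T a) w = (\<Sum>k\<le>n. nc_coeff ((T ^^ k) a) w / fact k)"
  unfolding nc_coeff_op_exp
  by (rule sum.mono_neutral_left) (use assms in \<open>auto simp: nc_coeff_funpow_eq_0\<close>)

lemma nc_raises_order_commutator:
  fixes z :: "('v, 'k::ring_1) ncfps"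
  assumes "nc_coeff z [] = 0"
  shows "nc_raises_order (nc_commutator z)"
  unfolding nc_raises_order_def
proof (intro allI impI)
  fix b :: "('v, 'k) ncfps" and m and w :: "'v list"
  assume b: "\<forall>u. length u < m \<longrightarrow> nc_coeff b u = 0" and w: "length w < Suc m"
  have "nc_coeff z (take i w) * nc_coeff b (drop i w) = 0" if "i \<le> length w" for i
    using assms b w that by (cases "i = 0") auto
  moreover have "nc_coeff b (take i w) * nc_coeff z (drop i w) = 0" if "i \<le> length w" for i
    using assms b w that by (cases "i = length w") auto
  ultimately show "nc_coeff (nc_commutator z b) w = 0"
    by (simp add: nc_commutator_def nc_coeff_mult)
qed


section \<open>The partial derivatives\<close>

definition nc_partial :: "'v::finite \<Rightarrow> ('v, 'k::field) ncfps \<Rightarrow> ('v, 'k) ncfps"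
  where "nc_partial i a =
    (THE d. \<exists>c. a = nc_scale c 1 + (\<Sum>j\<in>UNIV. d j * nc_var j)) i"

lemma nc_coeff_var: "nc_coeff (nc_var i) w = (if w = [i] then 1 else 0)"
  by (simp add: nc_var.rep_eq)

lemma nc_coeff_sum: "nc_coeff (\<Sum>x\<in>S. g x) w = (\<Sum>x\<in>S. nc_coeff (g x) w)"
  by (induction S rule: infinite_finite_induct) auto

lemma nc_coeff_mult_var_Nil: "nc_coeff (a * nc_var i) [] = 0"
  by (simp add: nc_coeff_mult nc_coeff_var)

lemma nc_coeff_mult_var_snoc:
  "nc_coeff (a * nc_var i) (w @ [j]) = (if i = j then nc_coeff a w else 0)"
proof -
  have "nc_coeff (a * nc_var i) (w @ [j])
      = (\<Sum>k\<le>Suc (length w). if k = length w then (if i = j then nc_coeff a w else 0) else 0)"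
    unfolding nc_coeff_mult length_append_singleton
  proof (intro sum.cong refl)
    fix k assume k: "k \<in> {..Suc (length w)}"
    have "k = length w" if "drop k (w @ [j]) = [i]"
      using k arg_cong[OF that, of length] unfolding length_drop by simp
    then show "nc_coeff a (take k (w @ [j])) * nc_coeff (nc_var i) (drop k (w @ [j]))
        = (if k = length w then (if i = j then nc_coeff a w else 0) else 0)"
      by (auto simp: nc_coeff_var)
  qed
  then show ?thesis by simp
qed

lemma nc_coeff_var_mult_Nil: "nc_coeff (nc_var i * a) [] = 0"
  by (simp add: nc_coeff_mult nc_coeff_var)

lemma nc_coeff_var_mult_Cons:
  "nc_coeff (nc_var i * a) (j # w) = (if i = j then nc_coeff a w else 0)"
proof -
  have "nc_coeff (nc_var i * a) (j # w)
      = (\<Sum>k\<le>Suc (length w). if k = Suc 0 then (if i = j then nc_coeff a w else 0) else 0)"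
    unfolding nc_coeff_mult list.size add_Suc_right add_0_right
    by (intro sum.cong refl) (auto simp: nc_coeff_var take_Cons' drop_Cons')
  then show ?thesis by (simp only: sum.delta finite_atMost) simp
qed

lemma nc_decomposition_iff:
  fixes d :: "'v::finite \<Rightarrow> ('v, 'k::field) ncfps"
  shows "a = nc_scale c 1 + (\<Sum>j\<in>UNIV. d j * nc_var j) \<longleftrightarrow>
    c = nc_coeff a [] \<and> (\<forall>i w. nc_coeff (d i) w = nc_coeff a (w @ [i]))"
proof -
  let ?b = "nc_scale c 1 + (\<Sum>j\<in>UNIV. d j * nc_var j)"
  have "nc_coeff ?b [] = c"
    by (simp add: nc_coeff_sum nc_coeff_mult_var_Nil nc_coeff_one)
  moreover have "nc_coeff ?b (w @ [i]) = nc_coeff (d i) w" for w i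
    by (simp add: nc_coeff_sum nc_coeff_mult_var_snoc nc_coeff_one)
  ultimately show ?thesis
    unfolding ncfps_eq_iff by (metis rev_exhaust)
qed

lemma nc_partial_unique_decomposition:
  fixes a :: "('v::finite, 'k::field) ncfps"
  shows "\<exists>!d. \<exists>c. a = nc_scale c 1 + (\<Sum>j\<in>UNIV. d j * nc_var j)"
proof (rule ex1I)
  show "\<exists>c. a = nc_scale c 1 + (\<Sum>j\<in>UNIV. Abs_ncfps (\<lambda>w. nc_coeff a (w @ [j])) * nc_var j)"
    unfolding nc_decomposition_iff by (simp add: Abs_ncfps_inverse)
  fix d :: "'v \<Rightarrow> ('v, 'k) ncfps"
  assume "\<exists>c. a = nc_scale c 1 + (\<Sum>j\<in>UNIV. d j * nc_var j)"
  then show "d = (\<lambda>j. Abs_ncfps (\<lambda>w. nc_coeff a (w @ [j])))"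
    unfolding nc_decomposition_iff by (auto simp: fun_eq_iff ncfps_eq_iff Abs_ncfps_inverse)
qed

lemma nc_coeff_partial: "nc_coeff (nc_partial i a) w = nc_coeff a (w @ [i])"
  using theI'[OF nc_partial_unique_decomposition[of a]]
  unfolding nc_decomposition_iff nc_partial_def by blast

lemma nc_partial_decomposition:
  "a = nc_scale (nc_coeff a []) 1 + (\<Sum>j\<in>UNIV. nc_partial j a * nc_var j)"
  unfolding nc_decomposition_iff by (simp add: nc_coeff_partial)


section \<open>The anti-involution\<close>

definition nc_anti_involution :: "(('v, 'k::field) ncfps \<Rightarrow> ('v, 'k) ncfps) \<Rightarrow> bool"
  where "nc_anti_involution t \<longleftrightarrow> Vector_Spaces.linear nc_scale nc_scale t \<and>
    (\<forall>a b. t (a * b) = t b * t a) \<and> (\<forall>a. t (t a) = a)"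

definition nc_tau :: "('v::finite, 'k::field) ncfps \<Rightarrow> ('v, 'k) ncfps"
  where "nc_tau = (THE t. nc_anti_involution t \<and> (\<forall>a\<in>lie. t a = - a))"

lemma nc_var_in_lie: "(nc_var i :: ('v, 'k::field) ncfps) \<in> lie"
proof -
  have "nc_hom_part d (nc_var i :: ('v, 'k) ncfps) = (if d = 1 then nc_var i else 0)" for d
    by (auto simp: ncfps_eq_iff nc_hom_part.rep_eq nc_coeff_var)
  then show ?thesis by (auto simp: lie_def intro: lie_poly.intros)
qed

lemma nc_tau_unique:
  fixes t :: "('v::finite, 'k::field) ncfps \<Rightarrow> ('v, 'k) ncfps"
  assumes t: "nc_anti_involution t" and neg: "\<forall>a\<in>lie. t a = - a"
  shows "nc_coeff (t a) w = (-1) ^ length w * nc_coeff a (rev w)"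
proof (induction w arbitrary: a)
  have lin: "Vector_Spaces.linear nc_scale nc_scale t"
    and mult: "t (a * b) = t b * t a" and inv: "t (t a) = a" for a b
    using t by (auto simp: nc_anti_involution_def)
  interpret t: Vector_Spaces.linear nc_scale nc_scale t by (rule lin)
  have "t 1 = t 1 * t (t 1)" by (simp add: inv)
  also have "\<dots> = t (t 1 * 1)" by (simp only: mult)
  finally have one: "t 1 = 1" by (simp add: inv)
  have eq: "t a = nc_scale (nc_coeff a []) 1 + (\<Sum>j\<in>UNIV. - (nc_var j * t (nc_partial j a)))" for a
    by (subst nc_partial_decomposition[of a])
       (simp add: t.add t.scale t.sum one mult neg[rule_format, OF nc_var_in_lie])
  {
    case Nil
    show ?case
      by (subst eq) (simp add: nc_coeff_sum nc_coeff_var_mult_Nil nc_coeff_one)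
  next
    case (Cons i w)
    have "nc_coeff (t a) (i # w) = - nc_coeff (t (nc_partial i a)) w"
      by (subst eq) (simp add: nc_coeff_sum nc_coeff_var_mult_Cons nc_coeff_one sum_negf)
    then show ?case by (simp add: Cons.IH nc_coeff_partial)
  }
qed

lemma nc_tau_exists:
  fixes t :: "('v::finite, 'k::field) ncfps \<Rightarrow> ('v, 'k) ncfps"
  defines "t \<equiv> \<lambda>a. Abs_ncfps (\<lambda>w. (-1) ^ length w * nc_coeff a (rev w))"
  shows "nc_anti_involution t \<and> (\<forall>a\<in>lie. t a = - a)"
proof -
  have c: "nc_coeff (t a) w = (-1) ^ length w * nc_coeff a (rev w)" for a w
    by (simp add: t_def Abs_ncfps_inverse)
  have lin: "t (a + b) = t a + t b" "t (nc_scale s a) = nc_scale s (t a)" for a b s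
    by (auto simp: ncfps_eq_iff c algebra_simps)
  have mult: "t (a * b) = t b * t a" for a b
  proof (rule ncfps_eqI)
    fix w
    have "nc_coeff (t (a * b)) w = (\<Sum>i\<le>length w. (-1) ^ length w *
        (nc_coeff a (take i (rev w)) * nc_coeff b (drop i (rev w))))"
      by (simp add: c nc_coeff_mult sum_distrib_left)
    also have "\<dots> = (\<Sum>i\<le>length w. nc_coeff (t b) (take i w) * nc_coeff (t a) (drop i w))"
    proof (rule sum.reindex_bij_witness[where i = "\<lambda>i. length w - i" and j = "\<lambda>i. length w - i"])
      fix i assume i: "i \<in> {..length w}"
      then have "(-1::'k) ^ length w = (-1) ^ (length w - i) * (-1) ^ i"
        by (simp flip: power_add)
      with i show "nc_coeff (t b) (take (length w - i) w) * nc_coeff (t a) (drop (length w - i) w) =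
          (-1) ^ length w * (nc_coeff a (take i (rev w)) * nc_coeff b (drop i (rev w)))"
        by (simp add: c take_rev drop_rev algebra_simps)
    qed auto
    finally show "nc_coeff (t (a * b)) w = nc_coeff (t b * t a) w"
      by (simp add: nc_coeff_mult)
  qed
  have inv: "t (t a) = a" for a
    by (auto simp: ncfps_eq_iff c simp flip: mult.assoc power_add power_mult_distrib)
  have poly: "t a = - a" if "a \<in> lie_poly" for a
    using that
  proof induction
    case (var i)
    show ?case by (auto simp: ncfps_eq_iff c nc_coeff_var rev_swap)
  next
    case (bracket a b)
    have "t (nc_commutator a b) = t (a * b + nc_scale (-1) (b * a))"
      by (simp add: nc_commutator_def)
    also have "\<dots> = - nc_commutator a b"
      unfolding lin mult bracket.IH by (simp add: nc_commutator_def)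
    finally show ?case .
  qed (auto simp: lin ncfps_eq_iff c)
  have "t a = - a" if "a \<in> lie" for a
  proof (rule ncfps_eqI)
    fix w :: "'v list"
    have "t (nc_hom_part (length w) a) = - nc_hom_part (length w) a"
      using that by (intro poly) (simp add: lie_def)
    then have "nc_coeff (t (nc_hom_part (length w) a)) w = nc_coeff (- nc_hom_part (length w) a) w"
      by simp
    then show "nc_coeff (t a) w = nc_coeff (- a) w"
      by (simp add: c nc_hom_part.rep_eq)
  qed
  moreover have "Vector_Spaces.linear nc_scale nc_scale t"
    by (intro Vector_Spaces.linear_iff[THEN iffD2] conjI allI nc.vector_space_axioms lin)
  ultimately show ?thesis
    by (auto simp: nc_anti_involution_def mult inv)
qed

lemma nc_tau_ex1:
  "\<exists>!t. nc_anti_involution t \<and> (\<forall>a\<in>lie :: ('v::finite, 'k::field) ncfps set. t a = - a)"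
proof -
  have "t = t'" if "nc_anti_involution t \<and> (\<forall>a\<in>lie. t a = - a)"
    and "nc_anti_involution t' \<and> (\<forall>a\<in>lie. t' a = - a)"
    for t t' :: "('v, 'k) ncfps \<Rightarrow> ('v, 'k) ncfps"
    using that by (auto simp: fun_eq_iff ncfps_eq_iff nc_tau_unique)
  then show ?thesis using nc_tau_exists by blast
qed

lemma nc_tau_anti_involution: "nc_anti_involution nc_tau"
  and nc_tau_lie: "a \<in> lie \<Longrightarrow> nc_tau a = - a"
  using theI'[OF nc_tau_ex1] by (auto simp: nc_tau_def)

lemma nc_coeff_tau: "nc_coeff (nc_tau a) w = (-1) ^ length w * nc_coeff a (rev w)"
  by (rule nc_tau_unique) (auto simp: nc_tau_anti_involution nc_tau_lie)


section \<open>The quotient space\<close>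

definition nc_comm :: "('v, 'k::field) ncfps set"
  where "nc_comm = nc.span {a * b - b * a | a b. True}"

definition nc_anti :: "('v::finite, 'k::field) ncfps set"
  where "nc_anti = {a. nc_tau a = - a}"

definition trquad_rel :: "('v::finite, 'k::field) ncfps \<Rightarrow> ('v, 'k) ncfps \<Rightarrow> bool"
  where "trquad_rel a b \<longleftrightarrow> a - b \<in> nc.span (nc_anti \<union> nc_comm)"

text \<open>Otherwise lifting to the quotient would go all the way down to coefficient functions.\<close>

lifting_forget ncfps.lifting

quotient_type (overloaded) ('v, 'k) trquad = "('v::finite, 'k::field) ncfps" / trquad_rel
proof (intro equivpI reflpI sympI transpI)
  fix a b c :: "('v, 'k) ncfps"
  show "trquad_rel a a"
    by (simp add: trquad_rel_def nc.span_zero)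
  show "trquad_rel b a" if "trquad_rel a b"
    using nc.span_neg[OF that[unfolded trquad_rel_def]] by (simp add: trquad_rel_def)
  show "trquad_rel a c" if "trquad_rel a b" "trquad_rel b c"
    using nc.span_add[OF that[unfolded trquad_rel_def]] by (simp add: trquad_rel_def)
qed

instantiation trquad :: (finite, field) ab_group_add
begin

lift_definition zero_trquad :: "('a, 'b) trquad" is 0 .
lift_definition plus_trquad :: "('a, 'b) trquad \<Rightarrow> ('a, 'b) trquad \<Rightarrow> ('a, 'b) trquad" is "(+)"
  unfolding trquad_rel_def by (simp only: add_diff_add nc.span_add)
lift_definition minus_trquad :: "('a, 'b) trquad \<Rightarrow> ('a, 'b) trquad \<Rightarrow> ('a, 'b) trquad" is "(-)"
proof -
  fix a b c d :: "('a, 'b) ncfps"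
  assume "trquad_rel a b" "trquad_rel c d"
  moreover have "a - c - (b - d) = (a - b) - (c - d)" by simp
  ultimately show "trquad_rel (a - c) (b - d)"
    unfolding trquad_rel_def by (simp only: nc.span_diff)
qed
lift_definition uminus_trquad :: "('a, 'b) trquad \<Rightarrow> ('a, 'b) trquad" is uminus
  unfolding trquad_rel_def by (simp only: minus_diff_minus nc.span_neg)

instance
proof
  fix a b c :: "('a, 'b) trquad"
  show "a + b + c = a + (b + c)"
    by transfer (simp add: trquad_rel_def nc.span_zero algebra_simps)
  show "a + b = b + a"
    by transfer (simp add: trquad_rel_def nc.span_zero algebra_simps)
  show "0 + a = a"
    by transfer (simp add: trquad_rel_def nc.span_zero)
  show "- a + a = 0"
    by transfer (simp add: trquad_rel_def nc.span_zero)
  show "a - b = a + - b"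
    by transfer (simp add: trquad_rel_def nc.span_zero)
qed

end

lift_definition trquad_scale :: "'k::field \<Rightarrow> ('v::finite, 'k) trquad \<Rightarrow> ('v, 'k) trquad"
  is nc_scale
  unfolding trquad_rel_def by (simp only: nc.scale_right_diff_distrib[symmetric] nc.span_scale)

lift_definition trquad :: "('v::finite, 'k::field) ncfps \<Rightarrow> ('v, 'k) trquad" is "\<lambda>a. a" .

lemma trquad_eq_iff: "trquad a = trquad b \<longleftrightarrow> a - b \<in> nc.span (nc_anti \<union> nc_comm)"
  by transfer (simp add: trquad_rel_def)

global_interpretation trq: vector_space "trquad_scale :: 'k::field \<Rightarrow> ('v::finite, 'k) trquad \<Rightarrow> _"
  by standard (transfer; simp add: trquad_rel_def nc.span_zero nc.scale_right_distrib nc.scale_left_distrib)+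

lemma trquad_linear: "Vector_Spaces.linear nc_scale trquad_scale trquad"
  by (intro Vector_Spaces.linear_iff[THEN iffD2] conjI allI nc.vector_space_axioms trq.vector_space_axioms)
     (transfer; simp add: trquad_rel_def nc.span_zero)+


section \<open>Two variables\<close>

datatype xy = VarX | VarY

instance xy :: finite
proof
  have "(UNIV :: xy set) = {VarX, VarY}" using xy.exhaust by auto
  then show "finite (UNIV :: xy set)" by (metis finite.simps)
qed

abbreviation nc_x :: "(xy, 'k::field_char_0) ncfps" where "nc_x \<equiv> nc_var VarX"
abbreviation nc_y :: "(xy, 'k::field_char_0) ncfps" where "nc_y \<equiv> nc_var VarY"

text \<open>
  The quotient below is the honest power series \<open>t / (e\<^sup>t - 1)\<close>, since library division of power
  series cancels the common factor \<open>t\<close>; its coefficients are \<open>B\<^sub>k / k!\<close> with \<open>B\<^sub>1 = -1/2\<close>.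
\<close>

definition bernoulli_fps :: "'k::field_char_0 fps"
  where "bernoulli_fps = fps_X / (fps_exp 1 - 1)"

definition duflo_fps :: "'k::field_char_0 fps"
  where "duflo_fps = bernoulli_fps - 1 + fps_const (1 / 2) * fps_X"

lemma bernoulli_fps_mult: "bernoulli_fps * (fps_exp 1 - 1) = (fps_X :: 'k::field_char_0 fps)"
proof -
  have nz: "fps_nth (fps_exp 1 - 1 :: 'k fps) 1 \<noteq> 0" by simp
  then have "fps_exp 1 - 1 \<noteq> (0 :: 'k fps)" by force
  moreover have "subdegree (fps_exp 1 - 1 :: 'k fps) \<le> 1"
    using nz by (rule subdegree_leI)
  ultimately show ?thesis
    unfolding bernoulli_fps_def by (intro fps_times_divide_eq) auto
qed

lemma bernoulli_fps_nth_0: "fps_nth bernoulli_fps 0 = (1 :: 'k::field_char_0)"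
  using arg_cong[OF bernoulli_fps_mult, of "\<lambda>f. fps_nth f 1"]
  by (simp add: fps_mult_nth)

lemma bernoulli_fps_nth_1: "fps_nth bernoulli_fps 1 = (- 1 / 2 :: 'k::field_char_0)"
proof -
  have "fps_nth bernoulli_fps 0 / 2 + fps_nth bernoulli_fps 1 = (0 :: 'k)"
    using arg_cong[OF bernoulli_fps_mult, of "\<lambda>f. fps_nth f 2"]
    by (simp add: fps_mult_nth numeral_2_eq_2)
  then show ?thesis
    by (simp add: bernoulli_fps_nth_0 add_eq_0_iff)
qed

lemma duflo_fps_nth:
  "fps_nth duflo_fps k = (if k < 2 then 0 else fps_nth bernoulli_fps k :: 'k::field_char_0)"
  using bernoulli_fps_nth_0[where 'k='k] bernoulli_fps_nth_1[where 'k='k]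
  by (cases k; cases "k - 1") (auto simp: duflo_fps_def)

end

theory Submission
  imports Defs
begin

text \<open>
  A linear functional on series that is cyclic and \<open>\<tau>\<close>-invariant is called a quadratic trace below.
  Quadratic traces separate the points of the quotient (\<open>trquad_eqI\<close>), so the theorem is an
  identity between scalars \<open>t(\<dots>)\<close>, one for each quadratic trace \<open>t\<close>.

  Besides \<open>\<partial>\<^sub>i\<close>, which strips a final letter, let \<open>\<lambda>\<^sub>i\<close> strip an initial one.  On Lie series
  \<open>\<lambda>\<^sub>i a = \<tau>(\<partial>\<^sub>i a)\<close>, because \<open>\<tau>\<close> reverses words and negates Lie series.  Let \<open>F\<close> be the left-hand
  side of the hypothesis, \<open>F = A - e\<^sup>-\<^sup>x A e\<^sup>x + e\<^sup>y B e\<^sup>-\<^sup>y - B\<close>.  In \<open>\<lambda>\<^sub>x \<partial>\<^sub>x F\<close> every term with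
  \<open>B\<close> disappears, and \<open>\<partial>\<^sub>x A\<close>, \<open>\<tau>(\<partial>\<^sub>x A)\<close> and \<open>A\<close> occur between power series in \<open>x\<close>.  After
  multiplication by a power series in \<open>x\<close> a quadratic trace can gather all these series on one side
  and replace \<open>\<tau>(\<partial>\<^sub>x A)\<close> by \<open>\<partial>\<^sub>x A\<close>.  With the right multiplier, \<open>x\<^sup>2 coth(x/2)\<close>, one gets
  \<open>t(x \<partial>\<^sub>x A)\<close> up to an error that a multiple of \<open>t(x \<partial>\<^sub>x F)\<close> removes at the price of mixed
  terms \<open>t(x (e\<^sup>y - 1) \<partial>\<^sub>x B)\<close>.  The same with \<open>x\<close> and \<open>y\<close> exchanged gives \<open>t(y \<partial>\<^sub>y B)\<close> and the other
  mixed terms, and together these mixed terms are \<open>t(y (\<lambda>\<^sub>y \<partial>\<^sub>x F) x)\<close>.  So \<open>t(x \<partial>\<^sub>x A + y \<partial>\<^sub>y B)\<close>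
  is a linear expression in \<open>F\<close> alone (\<open>second_order_form_conjugation\<close>).

  By hypothesis the expression may be evaluated at \<open>x + y - Z\<close> with \<open>Z = ch(y,x)\<close>.  It vanishes on
  \<open>x + y\<close>.  The derivatives of \<open>Z\<close> come from differentiating \<open>e\<^sup>Z = e\<^sup>y e\<^sup>x\<close>, and what results are
  traces of \<open>h(Z)\<close>, \<open>h(Z) e\<^sup>x\<close> and \<open>h(Z) e\<^sup>y\<close>.  The last two kinds are exchanged by \<open>\<tau>\<close>, since
  \<open>e\<^sup>-\<^sup>y = e\<^sup>x e\<^sup>-\<^sup>Z\<close>; they cancel down to \<open>t(e\<^sup>x + e\<^sup>y)\<close>, which is absorbed by the one-variable terms,
  and the even part of the first kind is, up to a constant, a multiple of the Duflo series
  (\<open>second_order_form_ch\<close>).  Finally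
  \<open>ch(x,y)\<close> and \<open>ch(y,x)\<close> are conjugate, so that power series in them have the same traces.
\<close>

section \<open>Functional calculus for power series\<close>

lemma nc_coeff_mult_cong:
  assumes "\<And>u. length u \<le> length w \<Longrightarrow> nc_coeff a u = nc_coeff a' u"
    and "\<And>u. length u \<le> length w \<Longrightarrow> nc_coeff b u = nc_coeff b' u"
  shows "nc_coeff (a * b) w = nc_coeff (a' * b') w"
  unfolding nc_coeff_mult using assms by (intro sum.cong refl arg_cong2[where f = "(*)"]) auto

lemma nc_scale_mult_left: "nc_scale c a * b = nc_scale c (a * b)"
  and nc_scale_mult_right: "a * nc_scale c b = nc_scale c (a * b)"
  for a b :: "('v, 'k::field) ncfps"
  by (auto simp: ncfps_eq_iff nc_coeff_mult sum_distrib_left algebra_simps)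

lemma nc_coeff_mult_Nil [simp]: "nc_coeff (a * b) [] = nc_coeff a [] * nc_coeff b []"
  by (simp add: nc_coeff_mult)

lemma nc_coeff_var_Nil [simp]: "nc_coeff (nc_var i) [] = 0"
  by (simp add: nc_coeff_var)

lemma nc_coeff_one_Nil [simp]: "nc_coeff 1 [] = 1"
  by (simp add: nc_coeff_one)

lemma nc_coeff_subst_Nil [simp]: "nc_coeff (nc_subst f z) [] = fps_nth f 0"
  by (simp add: nc_coeff_subst)

text \<open>
  Coefficients of words of length at most \<open>n\<close> cannot tell \<open>f(z)\<close> from this finite sum, so identities
  between products of substituted series reduce to identities between finite sums.
\<close>

definition nc_subst_trunc :: "nat \<Rightarrow> 'k::field fps \<Rightarrow> ('v, 'k) ncfps \<Rightarrow> ('v, 'k) ncfps"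
  where "nc_subst_trunc n f z = (\<Sum>k\<le>n. nc_scale (fps_nth f k) (z ^ k))"

lemma nc_coeff_subst_trunc:
  assumes "nc_coeff z [] = 0" and "length w \<le> n"
  shows "nc_coeff (nc_subst f z) w = nc_coeff (nc_subst_trunc n f z) w"
  using nc_coeff_subst_upto[OF assms] by (simp add: nc_subst_trunc_def nc_coeff_sum)

lemma nc_subst_add: "nc_subst (f + g) z = nc_subst f z + nc_subst g z"
  and nc_subst_diff: "nc_subst (f - g) z = nc_subst f z - nc_subst g z"
  and nc_subst_uminus: "nc_subst (- f) z = - nc_subst f z"
  and nc_subst_const_mult: "nc_subst (fps_const c * f) z = nc_scale c (nc_subst f z)"
  by (auto simp: ncfps_eq_iff nc_coeff_subst sum.distrib sum_subtractf sum_negf sum_distrib_left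
      algebra_simps)

lemma nc_subst_one: "nc_subst 1 z = (1 :: ('v, 'k::field) ncfps)"
proof (rule ncfps_eqI)
  fix w :: "'v list"
  have "nc_coeff (nc_subst 1 z) w = (\<Sum>k\<le>length w. if k = 0 then nc_coeff 1 w else 0)"
    unfolding nc_coeff_subst by (intro sum.cong) auto
  then show "nc_coeff (nc_subst 1 z) w = nc_coeff 1 w"
    by (simp del: length_0_conv)
qed

lemma nc_subst_X:
  fixes z :: "('v, 'k::field) ncfps"
  assumes "nc_coeff z [] = 0"
  shows "nc_subst fps_X z = z"
proof (rule ncfps_eqI)
  fix w :: "'v list"
  have "nc_coeff (nc_subst fps_X z) w = (\<Sum>k\<le>Suc (length w). if k = 1 then nc_coeff z w else 0)"
    using assms unfolding nc_coeff_subst_upto[OF assms, of _ "Suc (length w)", OF le_SucI, OF le_refl]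
    by (intro sum.cong) (auto simp: fps_X_def)
  then show "nc_coeff (nc_subst fps_X z) w = nc_coeff z w"
    by (simp only: sum.delta finite_atMost) simp
qed

lemma nc_subst_mult:
  fixes z :: "('v, 'k::field) ncfps"
  assumes z: "nc_coeff z [] = 0"
  shows "nc_subst (f * g) z = nc_subst f z * nc_subst g z"
proof (rule ncfps_eqI)
  fix w :: "'v list"
  let ?n = "length w"
  let ?h = "\<lambda>k l. fps_nth f k * fps_nth g l * nc_coeff (z ^ (k + l)) w"
  have "nc_coeff (nc_subst f z * nc_subst g z) w
      = nc_coeff (nc_subst_trunc ?n f z * nc_subst_trunc ?n g z) w"
    using z by (intro nc_coeff_mult_cong nc_coeff_subst_trunc)
  also have "\<dots> = (\<Sum>k\<le>?n. \<Sum>l\<le>?n. ?h k l)"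
    by (simp add: nc_subst_trunc_def sum_product nc_coeff_sum nc_scale_mult_left
        nc_scale_mult_right power_add mult.assoc mult.left_commute)
  also have "\<dots> = (\<Sum>(k,l)\<in>{..?n} \<times> {..?n}. ?h k l)"
    by (simp add: sum.cartesian_product)
  also have "\<dots> = (\<Sum>(k,l)\<in>{(k,l). k + l \<le> ?n}. ?h k l)"
    by (rule sum.mono_neutral_right) (auto, meson nc_coeff_power_eq_0[OF z] not_le)
  also have "\<dots> = (\<Sum>m\<le>?n. \<Sum>k\<le>m. ?h k (m - k))"
    by (rule sum.triangle_reindex_eq)
  also have "\<dots> = nc_coeff (nc_subst (f * g) z) w"
    by (simp add: nc_coeff_subst fps_mult_nth sum_distrib_right atLeast0AtMost)
  finally show "nc_coeff (nc_subst (f * g) z) w = nc_coeff (nc_subst f z * nc_subst g z) w" ..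
qed

lemma nc_subst_power: "nc_coeff z [] = 0 \<Longrightarrow> nc_subst (f ^ n) z = nc_subst f z ^ n"
  by (induction n) (simp_all add: nc_subst_one nc_subst_mult)

lemma nc_subst_compose:
  fixes z :: "('v, 'k::field) ncfps"
  assumes z: "nc_coeff z [] = 0" and g: "fps_nth g 0 = 0"
  shows "nc_subst f (nc_subst g z) = nc_subst (f oo g) z"
proof (rule ncfps_eqI)
  fix w :: "'v list"
  let ?n = "length w"
  have "nc_coeff (nc_subst f (nc_subst g z)) w
      = (\<Sum>k\<le>?n. \<Sum>m\<le>?n. fps_nth f k * fps_nth (g ^ k) m * nc_coeff (z ^ m) w)"
    by (simp add: nc_coeff_subst sum_distrib_left mult.assoc flip: nc_subst_power[OF z])
  also have "\<dots> = (\<Sum>m\<le>?n. \<Sum>k\<le>?n. fps_nth f k * fps_nth (g ^ k) m * nc_coeff (z ^ m) w)"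
    by (rule sum.swap)
  also have "\<dots> = (\<Sum>m\<le>?n. \<Sum>k\<le>m. fps_nth f k * fps_nth (g ^ k) m * nc_coeff (z ^ m) w)"
    by (intro sum.cong refl sum.mono_neutral_right)
       (auto simp: startsby_zero_power_prefix[OF g])
  also have "\<dots> = nc_coeff (nc_subst (f oo g) z) w"
    by (simp add: nc_coeff_subst fps_compose_nth sum_distrib_right atLeast0AtMost)
  finally show "nc_coeff (nc_subst f (nc_subst g z)) w = nc_coeff (nc_subst (f oo g) z) w" .
qed

lemma nc_subst_minus:
  assumes z: "nc_coeff z [] = 0"
  shows "nc_subst f (- z) = nc_subst (f oo - fps_X) z"
  using nc_subst_compose[OF z, of "- fps_X" f] by (simp add: nc_subst_uminus nc_subst_X[OF z])

text \<open>
  Isolating one factor \<open>z\<close> on the right or on the left makes \<open>f(z)\<close> accessible to \<open>\<partial>\<^sub>i\<close> and \<open>\<lambda>\<^sub>i\<close>.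
\<close>

lemma nc_subst_shift:
  assumes z: "nc_coeff z [] = 0"
  shows "nc_subst f z = nc_scale (fps_nth f 0) 1 + nc_subst (fps_shift 1 f) z * z"
    and "nc_subst f z = nc_scale (fps_nth f 0) 1 + z * nc_subst (fps_shift 1 f) z"
proof -
  have const: "nc_subst (fps_const (fps_nth f 0)) z = nc_scale (fps_nth f 0) 1"
    using nc_subst_const_mult[of "fps_nth f 0" 1 z] by (simp add: nc_subst_one)
  have f: "f = fps_const (fps_nth f 0) + fps_shift 1 f * fps_X"
    by (simp add: fps_eq_iff fps_shift_def)
  have f': "f = fps_const (fps_nth f 0) + fps_X * fps_shift 1 f"
    by (subst f) (simp only: mult.commute)
  show "nc_subst f z = nc_scale (fps_nth f 0) 1 + nc_subst (fps_shift 1 f) z * z"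
    by (subst f) (simp only: nc_subst_add const nc_subst_mult[OF z] nc_subst_X[OF z])
  show "nc_subst f z = nc_scale (fps_nth f 0) 1 + z * nc_subst (fps_shift 1 f) z"
    by (subst f') (simp only: nc_subst_add const nc_subst_mult[OF z] nc_subst_X[OF z])
qed

lemma power_conjugate:
  fixes p q a :: "'a::monoid_mult"
  assumes "q * p = 1" "p * q = 1"
  shows "(p * a * q) ^ n = p * a ^ n * q"
proof (induction n)
  case (Suc n)
  have "(p * a * q) ^ Suc n = p * a * (q * p) * a ^ n * q"
    unfolding power_Suc Suc.IH by (simp only: mult.assoc)
  then show ?case by (simp add: assms mult.assoc)
qed (simp add: assms)

lemma nc_subst_conjugate:
  fixes a :: "('v, 'k::field) ncfps"
  assumes a: "nc_coeff a [] = 0" and qp: "q * p = 1" "p * q = 1"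
  shows "nc_subst f (p * a * q) = p * nc_subst f a * q"
proof (rule ncfps_eqI)
  fix w :: "'v list"
  let ?n = "length w"
  have "nc_coeff (p * nc_subst f a * q) w = nc_coeff (p * nc_subst_trunc ?n f a * q) w"
    by (intro nc_coeff_mult_cong nc_coeff_subst_trunc[OF a] refl) auto
  also have "p * nc_subst_trunc ?n f a * q = nc_subst_trunc ?n f (p * a * q)"
    by (simp add: nc_subst_trunc_def power_conjugate[OF qp] sum_distrib_left sum_distrib_right
        nc_scale_mult_left nc_scale_mult_right)
  also have "nc_coeff \<dots> w = nc_coeff (nc_subst f (p * a * q)) w"
    using a by (intro nc_coeff_subst_trunc[symmetric]) auto
  finally show "nc_coeff (nc_subst f (p * a * q)) w = nc_coeff (p * nc_subst f a * q) w" ..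
qed

section \<open>Exponential and logarithm\<close>

lemma nc_exp_minus:
  assumes z: "nc_coeff z [] = 0"
  shows "nc_exp (- z) = nc_subst (fps_exp (- 1)) z"
  by (simp add: nc_exp_def nc_subst_minus[OF z])

lemma fps_exp_cancel: "fps_exp (- 1) * fps_exp 1 = (1 :: 'k::field_char_0 fps)"
  by (simp flip: fps_exp_add_mult)

lemma nc_exp_inverse:
  fixes z :: "('v, 'k::field_char_0) ncfps"
  assumes z: "nc_coeff z [] = 0"
  shows "nc_exp z * nc_exp (- z) = 1" and "nc_exp (- z) * nc_exp z = 1"
proof -
  have "fps_exp 1 * fps_exp (- 1) = (1 :: 'k fps)"
    by (simp flip: fps_exp_add_mult)
  then show "nc_exp z * nc_exp (- z) = 1"
    unfolding nc_exp_minus[OF z] unfolding nc_exp_def nc_subst_mult[OF z, symmetric]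
    by (simp add: nc_subst_one)
  show "nc_exp (- z) * nc_exp z = 1"
    unfolding nc_exp_minus[OF z] unfolding nc_exp_def nc_subst_mult[OF z, symmetric]
    by (simp add: nc_subst_one fps_exp_cancel)
qed

lemma nc_coeff_exp_Nil [simp]: "nc_coeff (nc_exp z) [] = 1"
  by (simp add: nc_exp_def)

lemma nc_coeff_ln_Nil [simp]: "nc_coeff (nc_ln a) [] = 0"
  by (simp add: nc_ln_def)

lemma nc_exp_ln:
  fixes a :: "('v, 'k::field_char_0) ncfps"
  assumes "nc_coeff a [] = 1"
  shows "nc_exp (nc_ln a) = a"
proof -
  have a: "nc_coeff (a - 1) [] = 0" using assms by simp
  have "fps_exp 1 - 1 oo fps_ln 1 = (fps_X :: 'k fps)"
    using fps_inv_fps_exp_compose(2)[of "1 :: 'k"] by (simp add: fps_ln_fps_exp_inv)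
  then have "fps_exp 1 oo fps_ln 1 = (1 + fps_X :: 'k fps)"
    by (simp add: fps_compose_sub_distrib algebra_simps)
  then show ?thesis
    using nc_subst_compose[OF a, of "fps_ln 1" "fps_exp 1"]
    by (simp add: nc_exp_def nc_ln_def nc_subst_add nc_subst_one nc_subst_X[OF a])
qed

lemma nc_coeff_ch_Nil [simp]: "nc_coeff (ch a b) [] = 0"
  by (simp add: ch_def)

lemma nc_exp_ch: "nc_exp (ch a b) = nc_exp a * nc_exp b"
  by (simp add: ch_def nc_exp_ln)

text \<open>
  Already \<open>e\<^sup>a e\<^sup>b = e\<^sup>-\<^sup>b (e\<^sup>b e\<^sup>a) e\<^sup>b\<close>, and the logarithm, being a power series, commutes with conjugation.
\<close>

lemma ch_conjugate:
  assumes b: "nc_coeff b [] = 0"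
  shows "ch a b = nc_exp (- b) * ch b a * nc_exp b"
proof -
  have "nc_exp a * nc_exp b - 1 = nc_exp (- b) * (nc_exp b * nc_exp a - 1) * nc_exp b"
    by (simp add: algebra_simps nc_exp_inverse[OF b] flip: mult.assoc)
  then show ?thesis
    by (simp add: ch_def nc_ln_def nc_subst_conjugate nc_exp_inverse[OF b])
qed

text \<open>
  Left and right multiplication by \<open>z\<close> commute, so this is the binomial expansion of the \<open>k\<close>-th power
  of their difference.  The factorials are distributed so that summing over \<open>k\<close> gives a product
  of two exponential series.
\<close>

lemma ad_power_scaled:
  fixes z a :: "('v, 'k::field_char_0) ncfps"
  shows "nc_scale (1 / fact k) ((nc_commutator z ^^ k) a) =
    (\<Sum>i\<le>k. nc_scale (1 / (fact i * fact (k - i))) (z ^ i * a * (- z) ^ (k - i)))"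
    (is "_ = ?S k")
proof (induction k)
  case (Suc k)
  let ?T = "\<lambda>i j. z ^ i * a * (- z) ^ j"
  let ?c = "\<lambda>i j. 1 / (fact i * fact j) :: 'k"
  have comm: "(- z) ^ j * z = z * (- z) ^ j" for j
    by (induction j) (simp_all add: mult.assoc)
  have step: "nc_commutator z (?T i j) = ?T (Suc i) j + ?T i (Suc j)" for i j
    by (simp add: nc_commutator_def mult.assoc comm power_commutes)
  have lin: "nc_commutator z (\<Sum>i\<in>I. nc_scale (c i) (b i)) = (\<Sum>i\<in>I. nc_scale (c i) (nc_commutator z (b i)))"
    for I :: "nat set" and c b
    by (simp add: nc_commutator_def sum_distrib_left sum_distrib_right nc_scale_mult_left
        nc_scale_mult_right sum_subtractf nc.scale_right_diff_distrib)
  have lin1: "nc_commutator z (nc_scale c b) = nc_scale c (nc_commutator z b)" for c b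
    by (simp add: nc_commutator_def nc_scale_mult_left nc_scale_mult_right nc.scale_right_diff_distrib)
  have c1: "of_nat (Suc i) * ?c (Suc i) j = ?c i j" for i j
    by (simp del: of_nat_Suc)
  have c2: "of_nat (Suc j) * ?c i (Suc j) = ?c i j" for i j
    by (simp del: of_nat_Suc)
  \<comment> \<open>Multiplying by \<open>k + 1\<close> turns the step into the Pascal rule in the form \<open>i + (k + 1 - i) = k + 1\<close>.\<close>
  have "nc_scale (of_nat (Suc k)) (nc_scale (1 / fact (Suc k)) ((nc_commutator z ^^ Suc k) a))
      = nc_commutator z (nc_scale (1 / fact k) ((nc_commutator z ^^ k) a))"
    by (simp add: lin1 del: of_nat_Suc)
  also have "\<dots> = (\<Sum>i\<le>k. nc_scale (?c i (k - i)) (?T (Suc i) (k - i)))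
      + (\<Sum>i\<le>k. nc_scale (?c i (k - i)) (?T i (Suc (k - i))))"
    unfolding Suc.IH lin step nc.scale_right_distrib sum.distrib ..
  also have "(\<Sum>i\<le>k. nc_scale (?c i (k - i)) (?T (Suc i) (k - i)))
      = (\<Sum>i\<le>Suc k. nc_scale (of_nat i * ?c i (Suc k - i)) (?T i (Suc k - i)))"
    by (subst sum.atMost_Suc_shift) (simp only: c1 diff_Suc_Suc of_nat_0 mult_zero_left
        nc.scale_zero_left add_0_left)
  also have "(\<Sum>i\<le>k. nc_scale (?c i (k - i)) (?T i (Suc (k - i))))
      = (\<Sum>i\<le>Suc k. nc_scale (of_nat (Suc k - i) * ?c i (Suc k - i)) (?T i (Suc k - i)))"
    unfolding sum.atMost_Suc
    by (simp only: diff_self_eq_0 of_nat_0 mult_zero_left nc.scale_zero_left add_0_right)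
       (intro sum.cong refl, simp only: atMost_iff Suc_diff_le c2)
  also have "(\<Sum>i\<le>Suc k. nc_scale (of_nat i * ?c i (Suc k - i)) (?T i (Suc k - i)))
      + (\<Sum>i\<le>Suc k. nc_scale (of_nat (Suc k - i) * ?c i (Suc k - i)) (?T i (Suc k - i)))
      = nc_scale (of_nat (Suc k)) (?S (Suc k))"
    unfolding nc.scale_sum_right sum.distrib[symmetric]
  proof (intro sum.cong refl)
    fix i assume "i \<in> {..Suc k}"
    then have "of_nat i + of_nat (Suc k - i) = (of_nat (Suc k) :: 'k)"
      by (simp flip: of_nat_add del: of_nat_Suc)
    then show "nc_scale (of_nat i * ?c i (Suc k - i)) (?T i (Suc k - i))
      + nc_scale (of_nat (Suc k - i) * ?c i (Suc k - i)) (?T i (Suc k - i))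
      = nc_scale (of_nat (Suc k)) (nc_scale (?c i (Suc k - i)) (?T i (Suc k - i)))"
      by (simp only: nc.scale_scale flip: nc.scale_left_distrib distrib_right)
  qed
  finally show ?case
    by (simp only: nc.scale_cancel_left of_nat_eq_0_iff) simp
qed simp

lemma nc_coeff_triple_eq_0:
  assumes z: "nc_coeff z [] = 0" and "nc_coeff z' [] = 0" and "length w < i + j"
  shows "nc_coeff (z ^ i * a * z' ^ j) w = 0"
proof -
  have "nc_coeff (z ^ i * a) u = 0" if "length u < i" for u
    unfolding nc_coeff_mult using that by (intro sum.neutral) (auto simp: nc_coeff_power_eq_0[OF z])
  moreover have "length (take l w) < i \<or> length (drop l w) < j" for l
    using assms(3) by auto
  ultimately show ?thesis
    unfolding nc_coeff_mult[of "z ^ i * a"] using nc_coeff_power_eq_0[OF assms(2)]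
    by (intro sum.neutral ballI) (metis mult_zero_left mult_zero_right)
qed

lemma nc_op_exp_commutator:
  fixes z a :: "('v, 'k::field_char_0) ncfps"
  assumes z: "nc_coeff z [] = 0"
  shows "nc_op_exp (nc_commutator z) a = nc_exp z * a * nc_exp (- z)"
proof (rule ncfps_eqI)
  fix w :: "'v list"
  let ?n = "length w"
  let ?h = "\<lambda>i j. 1 / (fact i * fact j) * nc_coeff (z ^ i * a * (- z) ^ j) w"
  have z': "nc_coeff (- z) [] = 0" using z by simp
  have "nc_coeff (nc_exp z * a * nc_exp (- z)) w
      = nc_coeff (nc_subst_trunc ?n (fps_exp 1) z * a * nc_subst_trunc ?n (fps_exp 1) (- z)) w"
    unfolding nc_exp_def
    by (intro nc_coeff_mult_cong nc_coeff_subst_trunc z z' refl) auto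
  also have "\<dots> = (\<Sum>i\<le>?n. \<Sum>j\<le>?n. ?h i j)"
    by (simp add: nc_subst_trunc_def sum_distrib_right)
       (simp add: sum_distrib_left nc_coeff_sum nc_scale_mult_left nc_scale_mult_right mult.assoc mult.commute)
  also have "\<dots> = (\<Sum>(i,j)\<in>{..?n} \<times> {..?n}. ?h i j)"
    by (simp add: sum.cartesian_product)
  also have "\<dots> = (\<Sum>(i,j)\<in>{(i,j). i + j \<le> ?n}. ?h i j)"
    by (rule sum.mono_neutral_right) (auto, meson nc_coeff_triple_eq_0[OF z z'] not_le)
  also have "\<dots> = (\<Sum>k\<le>?n. \<Sum>i\<le>k. ?h i (k - i))"
    by (rule sum.triangle_reindex_eq)
  also have "\<dots> = (\<Sum>k\<le>?n. nc_coeff (nc_scale (1 / fact k) ((nc_commutator z ^^ k) a)) w)"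
    unfolding ad_power_scaled by (simp add: nc_coeff_sum)
  also have "\<dots> = nc_coeff (nc_op_exp (nc_commutator z) a) w"
    by (simp add: nc_coeff_op_exp)
  finally show "nc_coeff (nc_op_exp (nc_commutator z) a) w = nc_coeff (nc_exp z * a * nc_exp (- z)) w" ..
qed

section \<open>Left and right partial derivatives\<close>

lemma nc_partial_add [simp]: "nc_partial i (a + b) = nc_partial i a + nc_partial i b"
  and nc_partial_diff [simp]: "nc_partial i (a - b) = nc_partial i a - nc_partial i b"
  and nc_partial_scale [simp]: "nc_partial i (nc_scale c a) = nc_scale c (nc_partial i a)"
  and nc_partial_zero [simp]: "nc_partial i 0 = 0"
  and nc_partial_one [simp]: "nc_partial i 1 = 0"
  and nc_partial_var [simp]: "nc_partial i (nc_var j) = (if i = j then 1 else 0)"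
  by (auto simp: ncfps_eq_iff nc_coeff_partial nc_coeff_one nc_coeff_var)

lemma nc_partial_mult:
  "nc_partial i (a * b) = a * nc_partial i b + nc_scale (nc_coeff b []) (nc_partial i a)"
  by (rule ncfps_eqI) (simp add: nc_coeff_partial nc_coeff_mult mult.commute)

lemma nc_partial_subst:
  assumes z: "nc_coeff z [] = 0"
  shows "nc_partial i (nc_subst f z) = nc_subst (fps_shift 1 f) z * nc_partial i z"
  by (subst nc_subst_shift(1)[OF z]) (simp add: nc_partial_mult z)

definition nc_left_partial :: "'v \<Rightarrow> ('v, 'k) ncfps \<Rightarrow> ('v, 'k) ncfps"
  where "nc_left_partial i a = Abs_ncfps (\<lambda>w. nc_coeff a (i # w))"

lemma nc_coeff_left_partial: "nc_coeff (nc_left_partial i a) w = nc_coeff a (i # w)"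
  by (simp add: nc_left_partial_def Abs_ncfps_inverse)

lemma nc_left_partial_add [simp]:
    "nc_left_partial i (a + b) = nc_left_partial i a + nc_left_partial i b"
  and nc_left_partial_diff [simp]:
    "nc_left_partial i (a - b) = nc_left_partial i a - nc_left_partial i b"
  and nc_left_partial_scale [simp]:
    "nc_left_partial i (nc_scale c a) = nc_scale c (nc_left_partial i a)"
  and nc_left_partial_zero [simp]: "nc_left_partial i 0 = 0"
  and nc_left_partial_one [simp]: "nc_left_partial i 1 = 0"
  and nc_left_partial_var [simp]: "nc_left_partial i (nc_var j) = (if i = j then 1 else 0)"
  by (auto simp: ncfps_eq_iff nc_coeff_left_partial nc_coeff_one nc_coeff_var)

lemma nc_left_partial_mult:
  fixes a b :: "('v, 'k::ring_1) ncfps"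
  shows "nc_left_partial i (a * b) = nc_left_partial i a * b + nc_scale (nc_coeff a []) (nc_left_partial i b)"
  by (rule ncfps_eqI)
     (simp add: nc_coeff_left_partial nc_coeff_mult sum.atMost_Suc_shift del: sum.atMost_Suc)

lemma nc_left_partial_subst:
  assumes z: "nc_coeff z [] = 0"
  shows "nc_left_partial i (nc_subst f z) = nc_left_partial i z * nc_subst (fps_shift 1 f) z"
  by (subst nc_subst_shift(2)[OF z]) (simp add: nc_left_partial_mult z)

section \<open>The anti-involution\<close>

lemma nc_tau_mult: "nc_tau (a * b) = nc_tau b * nc_tau a"
  and nc_tau_tau [simp]: "nc_tau (nc_tau a) = a"
  using nc_tau_anti_involution by (auto simp: nc_anti_involution_def)

lemma nc_tau_diff: "nc_tau (a - b) = nc_tau a - nc_tau b"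
  and nc_tau_one: "nc_tau 1 = 1"
  by (auto simp: ncfps_eq_iff nc_coeff_tau nc_coeff_one algebra_simps)

lemma nc_tau_var: "nc_tau (nc_var i) = - nc_var i"
  by (simp add: nc_tau_lie nc_var_in_lie)

lemma nc_tau_power: "nc_tau (a ^ n) = nc_tau a ^ n"
  by (induction n) (simp_all add: nc_tau_one nc_tau_mult power_commutes)

lemma nc_tau_subst: "nc_tau (nc_subst f z) = nc_subst f (nc_tau z)"
  by (rule ncfps_eqI)
     (simp add: nc_coeff_tau nc_coeff_subst sum_distrib_left algebra_simps flip: nc_tau_power)

lemma nc_coeff_lie_Nil:
  fixes a :: "('v::finite, 'k::field_char_0) ncfps"
  assumes "a \<in> lie"
  shows "nc_coeff a [] = 0"
  using nc_coeff_tau[of a "[]"] by (simp add: nc_tau_lie[OF assms] eq_neg_iff_add_eq_0)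

lemma nc_left_partial_lie:
  assumes "a \<in> lie"
  shows "nc_left_partial i a = nc_tau (nc_partial i a)"
proof (rule ncfps_eqI)
  fix w
  have "nc_coeff a (i # w) = - nc_coeff (nc_tau a) (i # w)"
    by (simp add: nc_tau_lie[OF assms])
  then show "nc_coeff (nc_left_partial i a) w = nc_coeff (nc_tau (nc_partial i a)) w"
    by (simp add: nc_coeff_left_partial nc_coeff_tau nc_coeff_partial)
qed

section \<open>Quadratic traces\<close>

text \<open>
  These are the functionals on \<open>tr\<^sup>q\<^sup>u\<^sup>a\<^sup>d\<close>, taken as functionals on series: a functional kills the
  series with \<open>\<tau>(a) = -a\<close> exactly if it is \<open>\<tau>\<close>-invariant, since \<open>a - \<tau>(a)\<close> is such a series and
  \<open>2a = a - \<tau>(a)\<close> for each of them.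
\<close>

locale quadratic_trace =
  fixes t :: "('v::finite, 'k::field_char_0) ncfps \<Rightarrow> 'k"
  assumes add: "t (a + b) = t a + t b"
    and scale: "t (nc_scale c a) = c * t a"
    and cyclic: "t (a * b) = t (b * a)"
    and tau: "t (nc_tau a) = t a"
begin

lemma zero: "t 0 = 0"
  using add[of 0 0] by simp

lemma uminus: "t (- a) = - t a"
  using add[of a "- a"] by (simp add: zero eq_neg_iff_add_eq_0 add.commute)

lemma diff: "t (a - b) = t a - t b"
  using add[of a "- b"] by (simp add: uminus)

lemma subst_minus: "nc_tau z = - z \<Longrightarrow> t (nc_subst f (- z)) = t (nc_subst f z)"
  using tau[of "nc_subst f z"] by (simp add: nc_tau_subst)

end

text \<open>
  If the classes differed, their difference would be a nonzero vector, on which some linear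
  functional of the quotient takes the value 1; composed with the projection it is a quadratic trace.
\<close>

lemma trquad_eqI:
  fixes a b :: "('v::finite, 'k::field_char_0) ncfps"
  assumes "\<And>t :: ('v, 'k) ncfps \<Rightarrow> 'k. quadratic_trace t \<Longrightarrow> t a = t b"
  shows "trquad a = trquad b"
proof (rule ccontr)
  assume neq: "trquad a \<noteq> trquad b"
  interpret T: Vector_Spaces.linear nc_scale trquad_scale "trquad :: ('v, 'k) ncfps \<Rightarrow> _"
    by (rule trquad_linear)
  interpret K: vector_space "(*) :: 'k \<Rightarrow> 'k \<Rightarrow> 'k"
    by standard (auto simp: algebra_simps)
  interpret P: vector_space_pair "trquad_scale :: 'k \<Rightarrow> ('v, 'k) trquad \<Rightarrow> _" "(*) :: 'k \<Rightarrow> 'k \<Rightarrow> 'k" ..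
  let ?d = "trquad (a - b)"
  have d: "?d \<noteq> 0" using neq by (simp add: T.diff)
  then have "trq.independent {?d}"
    by simp
  then obtain g where g: "Vector_Spaces.linear trquad_scale (*) g" "g ?d = 1"
    using P.linear_independent_extend[of "{?d}" "\<lambda>_. 1"] by auto
  interpret g: Vector_Spaces.linear trquad_scale "(*)" g by (rule g(1))
  have "quadratic_trace (\<lambda>u. g (trquad u))"
  proof
    fix u v :: "('v, 'k) ncfps" and c :: 'k
    show "g (trquad (u + v)) = g (trquad u) + g (trquad v)" by (simp add: T.add g.add)
    show "g (trquad (nc_scale c u)) = c * g (trquad u)" by (simp add: T.scale g.scale)
    have "trquad (u * v) = trquad (v * u)"
      unfolding trquad_eq_iff nc_comm_def by (intro nc.span_base UnI2) blast
    then show "g (trquad (u * v)) = g (trquad (v * u))" by simp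
    have "nc_tau u - u \<in> nc_anti"
      by (simp add: nc_anti_def nc_tau_diff)
    then have "trquad (nc_tau u) = trquad u"
      unfolding trquad_eq_iff by (intro nc.span_base UnI1)
    then show "g (trquad (nc_tau u)) = g (trquad u)" by simp
  qed
  then have "g (trquad a) = g (trquad b)" by (rule assms)
  with g(2) show False by (simp add: T.diff g.diff)
qed

section \<open>Generating functions\<close>

text \<open>
  The series \<open>(e\<^sup>t - 1)/t\<close>.  It is what remains of \<open>e\<^sup>x\<close> after stripping a letter \<open>x\<close> on either side.
\<close>

definition expm1_quot :: "'k::field_char_0 fps"
  where "expm1_quot = fps_shift 1 (fps_exp 1)"

text \<open>
  The series \<open>t coth(t/2) = t (e\<^sup>t + 1)/(e\<^sup>t - 1)\<close>, which is twice the Duflo series plus 2.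
\<close>

definition coth_fps :: "'k::field_char_0 fps"
  where "coth_fps = 2 * bernoulli_fps + fps_X"

text \<open>
  With \<open>b = t/(e\<^sup>t - 1)\<close> this is \<open>b (b - 1)/t = (b - 1)/(e\<^sup>t - 1)\<close>.  It arises from stripping a letter
  off \<open>b(Z)\<close>: the factor \<open>(b - 1)/t\<close> is the series after stripping a \<open>Z\<close>, and stripping a letter off \<open>Z\<close>
  produces another factor \<open>b(Z)\<close>.
\<close>

definition bernoulli_quot :: "'k::field_char_0 fps"
  where "bernoulli_quot = bernoulli_fps * fps_shift 1 bernoulli_fps"

lemma fps_X_mult_shift: "fps_X * fps_shift 1 f = f - fps_const (fps_nth f 0)"
  for f :: "'a::comm_ring_1 fps"
  by (auto simp: fps_eq_iff)

lemma X_expm1_quot: "fps_X * expm1_quot = (fps_exp 1 - 1 :: 'k::field_char_0 fps)"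
  using fps_X_mult_shift[of "fps_exp 1 :: 'k fps"] by (simp add: expm1_quot_def)

lemma fps_X_cancel: "fps_X * f = fps_X * g \<Longrightarrow> f = g" for f g :: "'k::field fps"
  by simp

lemma bernoulli_expm1_quot: "bernoulli_fps * expm1_quot = (1 :: 'k::field_char_0 fps)"
proof (rule fps_X_cancel)
  show "fps_X * (bernoulli_fps * expm1_quot) = (fps_X * 1 :: 'k fps)"
    using bernoulli_fps_mult[where ?'k = 'k]
    by (simp add: mult.left_commute[of fps_X] X_expm1_quot)
qed

lemma shift_fps_exp_minus:
  "fps_shift 1 (fps_exp (- 1)) = (- (fps_exp (- 1) * expm1_quot) :: 'k::field_char_0 fps)"
proof (rule fps_X_cancel)
  show "fps_X * fps_shift 1 (fps_exp (- 1)) = (fps_X * - (fps_exp (- 1) * expm1_quot) :: 'k fps)"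
    using fps_X_mult_shift[of "fps_exp (- 1) :: 'k fps"] X_expm1_quot[where ?'k = 'k]
      fps_exp_cancel[where ?'k = 'k] by simp algebra
qed

lemma coth_expm1_quot: "coth_fps * expm1_quot = (fps_exp 1 + 1 :: 'k::field_char_0 fps)"
  using bernoulli_expm1_quot[where ?'k = 'k] X_expm1_quot[where ?'k = 'k]
  unfolding coth_fps_def by algebra

lemma bernoulli_quot_exp:
  "bernoulli_quot * fps_exp 1 = (bernoulli_fps - 1 + bernoulli_quot :: 'k::field_char_0 fps)"
proof -
  have "fps_X * fps_shift 1 bernoulli_fps = (bernoulli_fps - 1 :: 'k fps)"
    unfolding fps_X_mult_shift by (simp add: bernoulli_fps_nth_0)
  then show ?thesis
    using bernoulli_fps_mult[where ?'k = 'k] unfolding bernoulli_quot_def by algebra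
qed

lemma fps_exp_minus_one_neq_0: "fps_exp 1 - 1 \<noteq> (0 :: 'k::field_char_0 fps)"
  by simp

text \<open>
  The anti-involution sends \<open>f(z)\<close> to \<open>f(-z)\<close> whenever it negates \<open>z\<close>; composition with \<open>- fps_X\<close>
  expresses this reflection on the series.
\<close>

lemma reflect_mult: "(f * g) oo - fps_X = (f oo - fps_X) * (g oo - fps_X)"
  for f g :: "'k::field fps"
  by (rule fps_compose_mult_distrib) simp

lemma reflect_X: "fps_X oo - fps_X = (- fps_X :: 'k::field fps)"
  by (rule fps_X_fps_compose_startby0) simp

lemma reflect_bernoulli:
  "bernoulli_fps oo - fps_X = (bernoulli_fps * fps_exp 1 :: 'k::field_char_0 fps)"
proof -
  have "(bernoulli_fps * (fps_exp 1 - 1)) oo - fps_X = (fps_X oo - fps_X :: 'k fps)"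
    by (simp only: bernoulli_fps_mult)
  then have "(bernoulli_fps oo - fps_X) * (fps_exp (- 1) - 1) = (- fps_X :: 'k fps)"
    by (simp add: reflect_mult reflect_X fps_compose_sub_distrib)
  then have "(bernoulli_fps oo - fps_X) * (fps_exp 1 - 1)
      = (bernoulli_fps * fps_exp 1 * (fps_exp 1 - 1) :: 'k fps)"
    using bernoulli_fps_mult[where ?'k = 'k] fps_exp_cancel[where ?'k = 'k] by algebra
  then show ?thesis
    using fps_exp_minus_one_neq_0 mult_right_cancel by blast
qed

lemma reflect_bernoulli_quot:
  "bernoulli_quot oo - fps_X
    = (- (fps_exp 1 * (bernoulli_fps + bernoulli_quot)) :: 'k::field_char_0 fps)"
proof -
  have "(bernoulli_quot * fps_exp 1) oo - fps_X
      = (bernoulli_fps - 1 + bernoulli_quot) oo (- fps_X :: 'k fps)"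
    by (simp only: bernoulli_quot_exp)
  then have "(bernoulli_quot oo - fps_X) * fps_exp (- 1)
      = (bernoulli_fps * fps_exp 1 - 1 + (bernoulli_quot oo - fps_X) :: 'k fps)"
    by (simp add: reflect_mult reflect_bernoulli fps_compose_sub_distrib fps_compose_add_distrib)
  then have "(bernoulli_quot oo - fps_X) * (fps_exp 1 - 1)
      = (- (fps_exp 1 * (bernoulli_fps + bernoulli_quot)) * (fps_exp 1 - 1) :: 'k fps)"
    using bernoulli_quot_exp[where ?'k = 'k] fps_exp_cancel[where ?'k = 'k] by algebra
  then show ?thesis
    using fps_exp_minus_one_neq_0 mult_right_cancel by blast
qed

section \<open>The Campbell-Hausdorff series\<close>

lemma nc_ln_exp:
  fixes z :: "('v, 'k::field_char_0) ncfps"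
  assumes z: "nc_coeff z [] = 0"
  shows "nc_ln (nc_exp z) = z"
proof -
  have "nc_exp z - 1 = nc_subst (fps_exp 1 - 1) z"
    by (simp add: nc_exp_def nc_subst_diff nc_subst_one)
  then show ?thesis
    using fps_inv_fps_exp_compose(1)[of "1 :: 'k"]
    by (simp add: nc_ln_def nc_subst_compose[OF z] fps_ln_fps_exp_inv nc_subst_X[OF z])
qed

lemma nc_tau_exp: "nc_tau (nc_exp z) = nc_exp (nc_tau z)"
  by (simp add: nc_exp_def nc_tau_subst)

lemma nc_exp_minus_ch:
  fixes a b :: "('v, 'k::field_char_0) ncfps"
  assumes "nc_coeff a [] = 0" and "nc_coeff b [] = 0"
  shows "nc_exp (- ch a b) = nc_exp (- b) * nc_exp (- a)"
proof -
  have "nc_exp (- b) * nc_exp (- a) * nc_exp (ch a b) * nc_exp (- ch a b)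
      = nc_exp (- b) * (nc_exp (- a) * nc_exp a) * nc_exp b * nc_exp (- ch a b)"
    by (simp add: nc_exp_ch mult.assoc)
  then show ?thesis
    by (simp add: nc_exp_inverse assms mult.assoc)
qed

lemma nc_tau_ch:
  fixes a b :: "('v::finite, 'k::field_char_0) ncfps"
  assumes "nc_coeff a [] = 0" "nc_coeff b [] = 0" "nc_tau a = - a" "nc_tau b = - b"
  shows "nc_tau (ch a b) = - ch a b"
proof -
  have "nc_tau (ch a b) = nc_ln (nc_tau (nc_exp a * nc_exp b))"
    by (simp add: ch_def nc_ln_def nc_tau_subst nc_tau_diff nc_tau_one)
  also have "\<dots> = nc_ln (nc_exp (- ch a b))"
    by (simp add: nc_tau_mult nc_tau_exp nc_exp_minus_ch assms)
  also have "\<dots> = - ch a b"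
    by (simp add: nc_ln_exp)
  finally show ?thesis .
qed

section \<open>The divergence as a function of the Kashiwara-Vergne equation\<close>

lemma nc_subst_mult_assoc:
  "nc_coeff z [] = 0 \<Longrightarrow> nc_subst f z * (nc_subst g z * a) = nc_subst (f * g) z * a"
  by (simp add: nc_subst_mult mult.assoc)

context quadratic_trace
begin

text \<open>
  The two ways in which a quadratic trace simplifies a series \<open>a\<close> with power series in \<open>z\<close> next to it:
  cyclicity gathers them on one side, and \<open>\<tau>\<close>-invariance removes a \<open>\<tau>\<close> from \<open>a\<close>.
\<close>

lemma cyclic_sandwich:
  assumes "nc_coeff z [] = 0"
  shows "t (nc_subst f z * a * nc_subst g z) = t (nc_subst (f * g) z * a)"
  using cyclic[of "nc_subst f z * a" "nc_subst g z"]
  by (simp add: nc_subst_mult assms mult.assoc[symmetric] mult.commute[of f g])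

lemma tau_subst:
  assumes "nc_coeff z [] = 0" and "nc_tau z = - z"
  shows "t (nc_subst f z * nc_tau a) = t (nc_subst (f oo - fps_X) z * a)"
proof -
  have "t (nc_subst f z * nc_tau a) = t (a * nc_subst f (- z))"
    using tau[of "nc_subst f z * nc_tau a"] by (simp add: nc_tau_mult nc_tau_subst assms)
  then show ?thesis by (simp add: cyclic nc_subst_minus assms)
qed

text \<open>
  With \<open>x\<close>, \<open>y\<close> for the variables \<open>i\<close>, \<open>j\<close>, this is
  \<open>t(x\<^sup>2 coth(x/2) \<lambda>\<^sub>x\<partial>\<^sub>xF) + t(y\<^sup>2 coth(y/2) \<lambda>\<^sub>y\<partial>\<^sub>yF) + 2 t(x \<partial>\<^sub>xF) - 2 t(y \<partial>\<^sub>yF) - 2 t(y (\<lambda>\<^sub>y\<partial>\<^sub>xF) x)\<close>,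
  the expression that recovers four times the divergence of \<open>(A, B)\<close> from the left-hand side \<open>F\<close>
  of the Kashiwara-Vergne equation.  The factor four clears all denominators.
\<close>

definition second_order_form :: "'v \<Rightarrow> 'v \<Rightarrow> ('v, 'k) ncfps \<Rightarrow> 'k"
  where "second_order_form i j F =
    t (nc_subst (fps_X * coth_fps) (nc_var i) * nc_left_partial i (nc_partial i F))
    + t (nc_subst (fps_X * coth_fps) (nc_var j) * nc_left_partial j (nc_partial j F))
    + 2 * t (nc_var i * nc_partial i F) - 2 * t (nc_var j * nc_partial j F)
    - 2 * t (nc_var j * nc_left_partial j (nc_partial i F) * nc_var i)"

text \<open>
  The five terms contribute, with \<open>A\<^sub>x = \<partial>\<^sub>x A\<close> and so on,
  \<^item> \<open>2 t(x A\<^sub>x) + 2 t(x e\<^sup>-\<^sup>x A\<^sub>x) + 2 t(e\<^sup>x A)\<close>,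
  \<^item> \<open>2 t(y B\<^sub>y) + 2 t(y e\<^sup>y B\<^sub>y) - 2 t(e\<^sup>y B)\<close>,
  \<^item> \<open>2 t(x A\<^sub>x) - 2 t(x e\<^sup>-\<^sup>x A\<^sub>x) - 2 t(e\<^sup>x A) + 2 t(x (e\<^sup>y - 1) B\<^sub>x)\<close>,
  \<^item> \<open>2 t(y B\<^sub>y) - 2 t(y e\<^sup>y B\<^sub>y) + 2 t(e\<^sup>y B) - 2 t(y (1 - e\<^sup>-\<^sup>x) A\<^sub>y)\<close>,
  \<^item> \<open>- 2 t(x (e\<^sup>y - 1) B\<^sub>x) + 2 t(y (1 - e\<^sup>-\<^sup>x) A\<^sub>y)\<close>,
  and everything but \<open>4 t(x A\<^sub>x + y B\<^sub>y)\<close> cancels.  That \<open>A\<close> and \<open>B\<close> are Lie series enters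
  through \<open>\<lambda>\<^sub>x A = \<tau>(A\<^sub>x)\<close> and \<open>t(g(x) A) = - t(g(-x) A)\<close>, and their analogues for \<open>y\<close> and \<open>B\<close>.
\<close>

lemma second_order_form_conjugation:
  assumes A: "A \<in> lie" and B: "B \<in> lie" and ij: "i \<noteq> j"
  shows "second_order_form i j
      (A - nc_exp (- nc_var i) * A * nc_exp (nc_var i)
        + (nc_exp (nc_var j) * B * nc_exp (- nc_var j) - B))
    = 4 * t (nc_var i * nc_partial i A + nc_var j * nc_partial j B)"
proof -
  let ?S = "\<lambda>f. nc_subst f (nc_var i)" and ?R = "\<lambda>f. nc_subst f (nc_var j)"
  let ?s = "expm1_quot :: 'k fps" and ?e = "fps_exp 1 :: 'k fps" and ?e' = "fps_exp (- 1) :: 'k fps"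
  let ?F = "A - nc_exp (- nc_var i) * A * nc_exp (nc_var i)
        + (nc_exp (nc_var j) * B * nc_exp (- nc_var j) - B)"
  let ?Ai = "nc_partial i A" and ?Aj = "nc_partial j A"
  let ?Bi = "nc_partial i B" and ?Bj = "nc_partial j B"
  have ji: "j \<noteq> i" using ij by simp
  have A0: "nc_coeff A [] = 0" and B0: "nc_coeff B [] = 0"
    using A B by (simp_all add: nc_coeff_lie_Nil)
  have F: "?F = A - ?S ?e' * A * ?S ?e + (?R ?e * B * ?R ?e' - B)"
    by (simp add: nc_exp_minus) (simp add: nc_exp_def)
  note d = nc_partial_mult nc_left_partial_mult nc_partial_subst nc_left_partial_subst A0 B0 ij ji
    nc_left_partial_lie[OF A] nc_left_partial_lie[OF B] shift_fps_exp_minus[unfolded One_nat_def]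
    expm1_quot_def[symmetric, unfolded One_nat_def] nc_subst_uminus
  have Fi: "nc_partial i ?F = ?Ai - ?S ?e' * A * ?S ?s - ?S ?e' * ?Ai + ?R ?e * ?Bi - ?Bi"
    unfolding F by (simp add: d algebra_simps)
  have Fj: "nc_partial j ?F = ?Aj - ?S ?e' * ?Aj - ?R ?e * B * ?R (?e' * ?s) + ?R ?e * ?Bj - ?Bj"
    unfolding F by (simp add: d algebra_simps)
  have Fii: "nc_left_partial i (nc_partial i ?F)
      = ?S (?e' * ?s) * ?Ai + ?S (?e' * ?s) * A * ?S ?s - nc_tau ?Ai * ?S ?s"
    unfolding Fi by (simp add: d algebra_simps)
  have Fjj: "nc_left_partial j (nc_partial j ?F)
      = ?R ?s * ?Bj - ?R ?s * B * ?R (?e' * ?s) - nc_tau ?Bj * ?R (?e' * ?s)"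
    unfolding Fj by (simp add: d algebra_simps)
  have Fji: "nc_left_partial j (nc_partial i ?F) = ?R ?s * ?Bi - nc_tau ?Aj * ?S ?s"
    unfolding Fi by (simp add: d algebra_simps)
  let ?D = "coth_fps :: 'k fps" and ?X = "fps_X :: 'k fps"
  have x0: "nc_coeff (nc_var l) [] = (0 :: 'k)" and tx: "nc_tau (nc_var l) = (- nc_var l :: ('v, 'k) ncfps)" for l :: 'v
    by (simp_all add: nc_tau_var)
  have cyclic_sandwich: "t (nc_subst f (nc_var l) * a * nc_subst g (nc_var l)) = t (nc_subst (f * g) (nc_var l) * a)"
    for l f a g by (rule cyclic_sandwich[OF x0])
  have ts: "t (nc_subst f (nc_var l) * nc_tau a) = t (nc_subst (f oo - fps_X) (nc_var l) * a)"
    for l f a by (rule tau_subst[OF x0 tx])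
  note ma = nc_subst_mult_assoc[OF x0]
  have f1: "?X * ?D * (?e' * ?s) = ?X + ?X * ?e'"
    using coth_expm1_quot[where ?'k = 'k] fps_exp_cancel[where ?'k = 'k] by algebra
  have f2: "?X * ?D * (?e' * ?s) * ?s = ?e - ?e'"
    using coth_expm1_quot[where ?'k = 'k] fps_exp_cancel[where ?'k = 'k] X_expm1_quot[where ?'k = 'k]
    by algebra
  have f3: "?X * ?D * ?s = ?X + ?X * ?e"
    using coth_expm1_quot[where ?'k = 'k] by algebra
  have r3: "(?X + ?X * ?e) oo - ?X = - (?X + ?X * ?e')" and r1: "(?X + ?X * ?e') oo - ?X = - (?X + ?X * ?e)"
    by (simp_all add: fps_compose_add_distrib reflect_mult reflect_X)
  have tA: "t (?S ?e' * A) = - t (?S ?e * A)" and tB: "t (?R ?e' * B) = - t (?R ?e * B)"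
    using ts[of ?e i A] ts[of ?e j B] by (simp_all add: nc_tau_lie A B uminus)
  have tA0: "t A = 0" and tB0: "t B = 0"
    using tau[of A] tau[of B] by (simp_all add: nc_tau_lie A B uminus)
  have "t (?S (?X * ?D) * nc_left_partial i (nc_partial i ?F))
      = t (?S (?X * ?D * (?e' * ?s)) * ?Ai)
      + t (?S (?X * ?D * (?e' * ?s)) * A * ?S ?s)
      - t (?S (?X * ?D) * nc_tau ?Ai * ?S ?s)"
    unfolding Fii by (simp add: distrib_left right_diff_distrib add diff ma mult.assoc)
  also have "\<dots> = 2 * t (?S (?X + ?X * ?e') * ?Ai) + 2 * t (?S ?e * A)"
    unfolding cyclic_sandwich f1 f3 ts r3 f2[unfolded f1]
    by (simp add: nc_subst_diff nc_subst_add nc_subst_uminus diff add uminus left_diff_distrib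
        distrib_right tA)
  finally have Tii: "t (?S (?X * ?D) * nc_left_partial i (nc_partial i ?F))
      = 2 * t (?S (?X + ?X * ?e') * ?Ai) + 2 * t (?S ?e * A)" .
  have "t (?R (?X * ?D) * nc_left_partial j (nc_partial j ?F))
      = t (?R (?X * ?D * ?s) * ?Bj)
      - t (?R (?X * ?D * ?s) * B * ?R (?e' * ?s))
      - t (?R (?X * ?D) * nc_tau ?Bj * ?R (?e' * ?s))"
    unfolding Fjj by (simp add: right_diff_distrib diff ma mult.assoc)
  also have "\<dots> = 2 * t (?R (?X + ?X * ?e) * ?Bj) - 2 * t (?R ?e * B)"
  proof -
    have f2': "?X * ?D * ?s * (?e' * ?s) = ?e - ?e'"
      using f2 by (simp add: mult_ac)
    show ?thesis
      unfolding cyclic_sandwich f2'[unfolded f3] f1 f3 ts r1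
      by (simp add: nc_subst_diff nc_subst_add nc_subst_uminus diff add uminus left_diff_distrib
          distrib_right tB)
  qed
  finally have Tjj: "t (?R (?X * ?D) * nc_left_partial j (nc_partial j ?F))
      = 2 * t (?R (?X + ?X * ?e) * ?Bj) - 2 * t (?R ?e * B)" .
  have S: "?S (?X + f) = nc_var i + ?S f" "?R (?X + f) = nc_var j + ?R f"
    "?S (?X * f) = nc_var i * ?S f" "?R (?X * f) = nc_var j * ?R f" for f
    by (simp_all add: nc_subst_add nc_subst_mult nc_subst_X)
  have xs: "nc_var i * ?S ?s = ?S ?e - 1" "nc_var j * ?R ?s = ?R ?e - 1" "?S ?s * nc_var i = ?S ?e - 1"
    using nc_subst_shift[OF x0[of i], of ?e] nc_subst_shift[OF x0[of j], of ?e]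
    by (simp_all add: expm1_quot_def)
  have "t (nc_var i * (?S ?e' * A * ?S ?s)) = t (?S (?X * ?e' * ?s) * A)"
    using cyclic_sandwich[of "?X * ?e'" i A ?s] by (simp add: S mult.assoc)
  also have "?X * ?e' * ?s = 1 - ?e'"
    using fps_exp_cancel[where ?'k = 'k] X_expm1_quot[where ?'k = 'k] by algebra
  finally have Ti: "t (nc_var i * nc_partial i ?F) = t (nc_var i * ?Ai)
      - t (nc_var i * ?S ?e' * ?Ai) - t (?S ?e * A)
      + t (nc_var i * ?R ?e * ?Bi) - t (nc_var i * ?Bi)"
    unfolding Fi by (simp add: algebra_simps add diff nc_subst_diff nc_subst_one tA tA0)
  have "t (nc_var j * (?R ?e * B * ?R (?e' * ?s))) = t (?R (?X * ?e * (?e' * ?s)) * B)"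
    using cyclic_sandwich[of "?X * ?e" j B "?e' * ?s"] by (simp add: S mult.assoc)
  also have "?X * ?e * (?e' * ?s) = ?e - 1"
    using fps_exp_cancel[where ?'k = 'k] X_expm1_quot[where ?'k = 'k] by algebra
  finally have Tj: "t (nc_var j * nc_partial j ?F) = t (nc_var j * ?Aj)
      - t (nc_var j * ?S ?e' * ?Aj) - t (?R ?e * B)
      + t (nc_var j * ?R ?e * ?Bj) - t (nc_var j * ?Bj)"
    unfolding Fj by (simp add: algebra_simps add diff nc_subst_diff nc_subst_one tB0)
  have "nc_var j * nc_left_partial j (nc_partial i ?F) * nc_var i
      = (nc_var j * ?R ?s) * ?Bi * nc_var i - nc_var j * nc_tau ?Aj * (?S ?s * nc_var i)"
    unfolding Fji by (simp add: algebra_simps)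
  also have "t \<dots> = t (?R ?e * ?Bi * nc_var i) - t (?Bi * nc_var i)
      - t (nc_var j * nc_tau ?Aj * ?S ?e) + t (nc_var j * nc_tau ?Aj)"
    unfolding xs by (simp add: algebra_simps add diff)
  also have "t (?R ?e * ?Bi * nc_var i) = t (nc_var i * ?R ?e * ?Bi)"
    using cyclic[of "?R ?e * ?Bi" "nc_var i"] by (simp add: mult.assoc)
  also have "t (?Bi * nc_var i) = t (nc_var i * ?Bi)" by (rule cyclic)
  also have "t (nc_var j * nc_tau ?Aj * ?S ?e) = - t (nc_var j * ?S ?e' * ?Aj)"
    using tau[of "nc_var j * nc_tau ?Aj * ?S ?e"] cyclic[of "?S ?e' * ?Aj" "nc_var j"]
    by (simp add: nc_tau_mult nc_tau_subst tx nc_subst_minus x0 uminus mult.assoc)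
  also have "t (nc_var j * nc_tau ?Aj) = - t (nc_var j * ?Aj)"
    using tau[of "nc_var j * nc_tau ?Aj"] cyclic[of ?Aj "nc_var j"]
    by (simp add: nc_tau_mult tx uminus)
  finally have Tji: "t (nc_var j * nc_left_partial j (nc_partial i ?F) * nc_var i)
      = t (nc_var i * ?R ?e * ?Bi) - t (nc_var i * ?Bi)
      + t (nc_var j * ?S ?e' * ?Aj) - t (nc_var j * ?Aj)" by simp
  show ?thesis
    unfolding second_order_form_def Tii Tjj Ti Tj Tji
    by (simp add: S distrib_right add algebra_simps)
qed

end

section \<open>Evaluation at the Campbell-Hausdorff series\<close>

context quadratic_trace
begin

text \<open>
  With \<open>Z = ch(y,x)\<close>, \<open>b = t/(e\<^sup>t - 1)\<close>, \<open>g = b (b - 1)/t\<close> and \<open>s = (e\<^sup>t - 1)/t\<close> the derivatives are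
  \<open>\<partial>\<^sub>x Z = b(Z) e\<^sup>y s(x)\<close> and \<open>\<partial>\<^sub>y Z = b(Z) s(y)\<close>, and another letter stripped on the left turns \<open>b(Z)\<close>
  into \<open>g(Z)\<close>.  All traces then have the form \<open>t(h(Z))\<close>, \<open>t(h(Z) e\<^sup>x)\<close> or \<open>t(h(Z) e\<^sup>y)\<close>, apart from
  traces of power series in \<open>x\<close> or \<open>y\<close>.  Exchanging \<open>e\<^sup>x\<close> and \<open>e\<^sup>y\<close> by \<open>\<tau>\<close> amounts to
  \<open>b \<mapsto> b\<close> and \<open>g \<mapsto> - b - g\<close>, which makes the coefficients of the mixed traces cancel.
\<close>

lemma second_order_form_ch:
  assumes ij: "i \<noteq> j"
  shows "second_order_form i j (ch (nc_var j) (nc_var i))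
    = 2 * (t (nc_subst duflo_fps (ch (nc_var j) (nc_var i)))
        - t (nc_subst duflo_fps (nc_var i)) - t (nc_subst duflo_fps (nc_var j)))"
proof -
  let ?S = "\<lambda>f. nc_subst f (nc_var i)" and ?R = "\<lambda>f. nc_subst f (nc_var j)"
  let ?s = "expm1_quot :: 'k fps" and ?e = "fps_exp 1 :: 'k fps" and ?e' = "fps_exp (- 1) :: 'k fps"
  let ?D = "coth_fps :: 'k fps" and ?X = "fps_X :: 'k fps"
  let ?b = "bernoulli_fps :: 'k fps" and ?g = "bernoulli_quot :: 'k fps"
  define Z :: "('v, 'k) ncfps" where "Z = ch (nc_var j) (nc_var i)"
  let ?Z = "\<lambda>f. nc_subst f Z"
  \<comment> \<open>\<open>E = e\<^sup>x\<close> and \<open>G = e\<^sup>y\<close>, so that \<open>e\<^sup>Z = G E\<close>\<close>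
  define E G where "E = ?S ?e" and "G = ?R ?e"
  have ji: "j \<noteq> i" using ij by simp
  have x0: "nc_coeff (nc_var l) [] = (0 :: 'k)" and tx: "nc_tau (nc_var l) = (- nc_var l :: ('v, 'k) ncfps)" for l :: 'v
    by (simp_all add: nc_tau_var)
  have Z0: "nc_coeff Z [] = 0" and tZ: "nc_tau Z = - Z"
    by (simp_all add: Z_def nc_tau_ch nc_tau_var)
  have W: "?Z ?e = G * E"
    using nc_exp_ch[of "nc_var j :: ('v, 'k) ncfps" "nc_var i"] by (simp add: Z_def E_def G_def nc_exp_def)
  note d = nc_partial_mult nc_left_partial_mult nc_partial_subst nc_left_partial_subst Z0 ij ji
    expm1_quot_def[symmetric, unfolded One_nat_def]
  have b0: "fps_nth ?b 0 = 1" by (rule bernoulli_fps_nth_0)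
  have Zs: "?Z ?s * nc_partial l Z = nc_partial l (G * E)"
    "nc_left_partial l Z * ?Z ?s = nc_left_partial l (G * E)" for l
    by (simp_all add: d flip: W)
  have inv: "?Z ?b * (?Z ?s * a) = a" "a * ?Z ?s * ?Z ?b = a" for a
    using bernoulli_expm1_quot[where ?'k = 'k]
    by (simp_all add: mult.assoc nc_subst_mult_assoc Z0 mult.commute[of ?s ?b] nc_subst_one flip: nc_subst_mult)
  \<comment> \<open>Both derivatives of \<open>e\<^sup>Z\<close> contain the invertible factor \<open>s(Z)\<close>, whose inverse is \<open>b(Z)\<close>.\<close>
  have Zp: "nc_partial l Z = ?Z ?b * nc_partial l (G * E)"
    "nc_left_partial l Z = nc_left_partial l (G * E) * ?Z ?b" for l
    by (simp_all add: inv flip: Zs)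
  have Zi: "nc_partial i Z = ?Z ?b * G * ?S ?s" and Zj: "nc_partial j Z = ?Z ?b * ?R ?s"
    by (simp_all add: Zp) (simp_all add: E_def G_def d mult.assoc)
  have Li: "nc_left_partial i Z = ?S ?s * ?Z ?b" and Lj: "nc_left_partial j Z = ?R ?s * E * ?Z ?b"
    by (simp_all add: Zp) (simp_all add: E_def G_def d mult.assoc)
  have Lb: "nc_left_partial i (?Z ?b) = ?S ?s * ?Z ?g" "nc_left_partial j (?Z ?b) = ?R ?s * E * ?Z ?g"
    by (simp_all add: d Li Lj) (simp_all add: bernoulli_quot_def nc_subst_mult Z0 mult.assoc)
  let ?s1 = "fps_shift 1 ?s"
  have Zii: "nc_left_partial i (nc_partial i Z) = ?S ?s * ?Z ?g * G * ?S ?s + ?S ?s1"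
    unfolding Zi by (simp add: d Lb b0) (simp add: G_def d mult.assoc)
  have Zjj: "nc_left_partial j (nc_partial j Z) = ?R ?s * E * ?Z ?g * ?R ?s + ?R ?s1"
    unfolding Zj by (simp add: d Lb b0)
  have Zji: "nc_left_partial j (nc_partial i Z) = ?R ?s * E * ?Z ?g * G * ?S ?s + ?R ?s * ?S ?s"
    unfolding Zi by (simp add: d Lb b0) (simp add: G_def d mult.assoc distrib_right)
  have cyclic_sandwich: "t (nc_subst f (nc_var l) * a * nc_subst g (nc_var l)) = t (nc_subst (f * g) (nc_var l) * a)"
    for l f a g by (rule cyclic_sandwich[OF x0])
  have f1: "?X * ?D * ?s * ?s = ?e * ?e - 1"
    using coth_expm1_quot[where ?'k = 'k] X_expm1_quot[where ?'k = 'k] by algebra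
  have "fps_nth ?s 0 = 1" by (simp add: expm1_quot_def)
  then have "?X * ?s1 = ?s - 1"
    unfolding fps_X_mult_shift by simp
  then have f2: "?X * ?D * ?s1 = ?e + 1 - ?D"
    using coth_expm1_quot[where ?'k = 'k] by algebra
  have xs: "nc_var j * ?R ?s = G - 1" "?S ?s * nc_var i = E - 1" "?R ?s * nc_var j = G - 1"
    using nc_subst_shift[OF x0[of i], of ?e] nc_subst_shift[OF x0[of j], of ?e]
    by (simp_all add: expm1_quot_def E_def G_def)
  have GE: "G * (E * a) = ?Z ?e * a" for a
    by (simp add: W mult.assoc)
  note Zm = nc_subst_mult_assoc[OF Z0] nc_subst_mult[OF Z0, symmetric]
  have Tii: "t (?S (?X * ?D) * nc_left_partial i (nc_partial i Z))
      = t (?Z (?g * ?e) * E) - t (?Z ?g * G) + t E + t 1 - t (?S ?D)"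
  proof -
    have "t (?S (?X * ?D) * nc_left_partial i (nc_partial i Z))
        = t (?S (?X * ?D * ?s) * (?Z ?g * G) * ?S ?s) + t (?S (?X * ?D * ?s1))"
      unfolding Zii by (simp add: distrib_left add nc_subst_mult x0 mult.assoc)
    also have "\<dots> = t (E * E * (?Z ?g * G)) - t (?Z ?g * G) + t E + t 1 - t (?S ?D)"
      unfolding cyclic_sandwich f1 f2
      by (simp add: nc_subst_diff nc_subst_add nc_subst_one nc_subst_mult x0 E_def left_diff_distrib diff add)
    also have "t (E * E * (?Z ?g * G)) = t (?Z (?g * ?e) * E)"
      using cyclic[of "E * E" "?Z ?g * G"] by (simp add: mult.assoc GE Zm)
    finally show ?thesis .
  qed
  have Tjj: "t (?R (?X * ?D) * nc_left_partial j (nc_partial j Z))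
      = t (?Z (?g * ?e) * G) - t (?Z ?g * E) + t G + t 1 - t (?R ?D)"
  proof -
    have "t (?R (?X * ?D) * nc_left_partial j (nc_partial j Z))
        = t (?R (?X * ?D * ?s) * (E * ?Z ?g) * ?R ?s) + t (?R (?X * ?D * ?s1))"
      unfolding Zjj by (simp add: distrib_left add nc_subst_mult x0 mult.assoc)
    also have "\<dots> = t (G * (G * (E * ?Z ?g))) - t (E * ?Z ?g) + t G + t 1 - t (?R ?D)"
      unfolding cyclic_sandwich f1 f2
      by (simp add: nc_subst_diff nc_subst_add nc_subst_one nc_subst_mult x0 G_def left_diff_distrib diff add mult.assoc)
    also have "t (G * (G * (E * ?Z ?g))) = t (?Z (?g * ?e) * G)"
      using cyclic[of G "?Z (?e * ?g)"] by (simp add: GE Zm mult.commute)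
    also have "t (E * ?Z ?g) = t (?Z ?g * E)" by (rule cyclic)
    finally show ?thesis .
  qed
  have Ti: "t (nc_var i * nc_partial i Z) = t (?Z (?b * ?e)) - t (?Z ?b * G)"
  proof -
    have "t (nc_var i * nc_partial i Z) = t (?Z ?b * G * (?S ?s * nc_var i))"
      unfolding Zi using cyclic[of "nc_var i"] by (simp add: mult.assoc)
    then show ?thesis
      unfolding xs by (simp add: right_diff_distrib diff mult.assoc W[symmetric] Zm)
  qed
  have Tj: "t (nc_var j * nc_partial j Z) = t (?Z ?b * G) - t (?Z ?b)"
  proof -
    have "t (nc_var j * nc_partial j Z) = t (?Z ?b * (?R ?s * nc_var j))"
      unfolding Zj using cyclic[of "nc_var j"] by (simp add: mult.assoc)
    then show ?thesis
      unfolding xs by (simp add: right_diff_distrib diff)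
  qed
  have Tji: "t (nc_var j * nc_left_partial j (nc_partial i Z) * nc_var i)
      = t (?Z (?g * ?e * ?e)) - t (?Z (?g * ?e) * G) - t (?Z (?g * ?e) * E) + t (?Z (?g * ?e))
        + t (?Z ?e) - t G - t E + t 1"
  proof -
    have "nc_var j * nc_left_partial j (nc_partial i Z) * nc_var i
        = (nc_var j * ?R ?s) * E * ?Z ?g * G * (?S ?s * nc_var i)
          + (nc_var j * ?R ?s) * (?S ?s * nc_var i)"
      unfolding Zji by (simp add: algebra_simps)
    also have "\<dots> = ?Z (?e * ?g * ?e) - ?Z (?e * ?g) * G - E * ?Z (?g * ?e) + E * (?Z ?g * G)
          + ?Z ?e - G - E + 1"
      unfolding xs
      by (simp add: left_diff_distrib right_diff_distrib mult.assoc W[symmetric] GE Zm algebra_simps)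
    finally show ?thesis
      using cyclic[of E "?Z ?g * G"] cyclic[of E "?Z (?g * ?e)"]
      by (simp add: add diff mult.assoc W[symmetric] Zm mult_ac)
  qed
  \<comment> \<open>\<open>\<tau>\<close> sends \<open>f(Z) e\<^sup>y\<close> to \<open>e\<^sup>-\<^sup>y f(-Z)\<close>, and \<open>e\<^sup>-\<^sup>y = e\<^sup>x e\<^sup>-\<^sup>Z\<close>.\<close>
  have swap: "t (?Z f * G) = t (?Z (?e' * (f oo - ?X)) * E)" for f
  proof -
    have "t (?Z f * G) = t (nc_exp (- nc_var j) * ?Z (f oo - ?X))"
      using tau[of "?Z f * G"]
      by (simp add: G_def nc_tau_mult nc_tau_subst tZ tx nc_subst_minus Z0 nc_exp_minus x0)
    also have "nc_exp (- nc_var j) = E * ?Z ?e'"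
    proof -
      have "E * ?Z ?e' = nc_exp (nc_var i) * (nc_exp (- nc_var i) * nc_exp (- nc_var j))"
        by (simp add: E_def nc_exp_def[of "nc_var i"] Z_def flip: nc_exp_minus nc_exp_minus_ch)
      then show ?thesis
        by (simp add: nc_exp_inverse flip: mult.assoc)
    qed
    finally show ?thesis
      using cyclic[of E "?Z (?e' * (f oo - ?X))"] by (simp add: Zm mult.assoc)
  qed
  have eb: "?e' * (?b * ?e) = ?b"
    using fps_exp_cancel[where ?'k = 'k] by algebra
  have qb: "t (?Z ?b * G) = t (?Z ?b * E)"
    using swap[of ?b] unfolding reflect_bernoulli eb .
  have eg: "?e' * (- (?e * (?b + ?g))) = - ?b - ?g"
    using fps_exp_cancel[where ?'k = 'k] by algebra
  have qg: "t (?Z ?g * G) = - t (?Z ?b * E) - t (?Z ?g * E)"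
    using swap[of ?g] unfolding reflect_bernoulli_quot eg
    by (simp add: nc_subst_diff nc_subst_uminus diff uminus left_diff_distrib)
  have ge: "t (?Z (?g * ?e) * a) = t (?Z ?b * a) - t a + t (?Z ?g * a)" for a
    by (simp add: bernoulli_quot_exp nc_subst_diff nc_subst_add nc_subst_one distrib_right
        left_diff_distrib add diff)
  \<comment> \<open>Twice \<open>?k\<close> is, up to its constant, the sum of all \<open>h\<close> for which \<open>t(h(Z))\<close> occurs above.
    A quadratic trace sees only the even part of \<open>?k\<close>.\<close>
  let ?k = "?b * ?e + ?b - ?g * ?e * ?e - ?g * ?e - ?e - 1"
  have k: "?k = - ((?e + 1) * ?g)"
    using bernoulli_quot_exp[where ?'k = 'k] by algebra
  have "?k + (?k oo - ?X) = ?D"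
  proof -
    have "?k oo - ?X = (?e' + 1) * (?e * (?b + ?g))"
      unfolding k by (simp add: fps_compose_uminus reflect_mult fps_compose_add_distrib reflect_bernoulli_quot)
    then show ?thesis
      unfolding k coth_fps_def
      using fps_exp_cancel[where ?'k = 'k] bernoulli_fps_mult[where ?'k = 'k] by algebra
  qed
  then have "t (?Z ?D) = t (?Z ?k) + t (?Z (?k oo - ?X))"
    by (metis nc_subst_add add)
  also have "t (?Z (?k oo - ?X)) = t (?Z ?k)"
    using subst_minus[OF tZ] by (simp only: nc_subst_minus[OF Z0])
  finally have ZD: "t (?Z ?D) = 2 * (t (?Z (?b * ?e)) + t (?Z ?b) - t (?Z (?g * ?e * ?e))
      - t (?Z (?g * ?e)) - t (?Z ?e) - t 1)"
    by (simp add: nc_subst_diff nc_subst_add nc_subst_one diff add)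
  have duflo: "2 * t (nc_subst duflo_fps z) = t (nc_subst ?D z) - 2 * t 1" for z
    unfolding duflo_fps_def coth_fps_def mult_2[of ?b]
    by (simp only: nc_subst_diff nc_subst_add nc_subst_one nc_subst_const_mult diff add scale)
       (simp add: algebra_simps)
  show ?thesis
    unfolding Z_def[symmetric] second_order_form_def Tii Tjj Ti Tj Tji right_diff_distrib duflo ZD
      ge qb qg
    by (simp add: algebra_simps)
qed

end

section \<open>The divergence in the quadratic quotient\<close>

theorem theorem1:
  fixes A B :: "(xy, 'k::field_char_0) ncfps"
  assumes "A \<in> lie" and "B \<in> lie"
    and "(A - nc_op_exp (\<lambda>z. - nc_commutator nc_x z) A) + (nc_op_exp (nc_commutator nc_y) B - B)
      = nc_x + nc_y - ch nc_y nc_x"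
  shows "trquad (nc_x * nc_partial VarX A + nc_y * nc_partial VarY B)
    = trquad_scale (1 / 2)
        (trquad (nc_subst duflo_fps nc_x + nc_subst duflo_fps nc_y
          - nc_subst duflo_fps (ch nc_x nc_y)))"
proof -
  interpret T: Vector_Spaces.linear nc_scale trquad_scale "trquad :: (xy, 'k) ncfps \<Rightarrow> _"
    by (rule trquad_linear)
  have "(\<lambda>z. - nc_commutator nc_x z) = (nc_commutator (- nc_x) :: (xy, 'k) ncfps \<Rightarrow> _)"
    by (simp add: fun_eq_iff nc_commutator_def)
  then have eq: "A - nc_exp (- nc_x) * A * nc_exp nc_x + (nc_exp nc_y * B * nc_exp (- nc_y) - B)
      = nc_x + nc_y - ch nc_y nc_x"
    using assms(3) by (simp add: nc_op_exp_commutator)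
  show ?thesis
    unfolding T.scale[symmetric]
  proof (rule trquad_eqI)
    fix t :: "(xy, 'k) ncfps \<Rightarrow> 'k"
    assume "quadratic_trace t"
    then interpret quadratic_trace t .
    have tx: "t (nc_var l) = 0" for l
      using tau[of "nc_var l"] by (simp add: nc_tau_var uminus)
    have "4 * t (nc_x * nc_partial VarX A + nc_y * nc_partial VarY B)
        = second_order_form VarX VarY (nc_x + nc_y - ch nc_y nc_x)"
      using second_order_form_conjugation[OF assms(1,2), of VarX VarY] by (simp add: eq)
    also have "\<dots> = - second_order_form VarX VarY (ch nc_y nc_x)"
      by (simp add: second_order_form_def diff uminus tx zero algebra_simps)
    also have "\<dots> = 2 * (t (nc_subst duflo_fps nc_x) + t (nc_subst duflo_fps nc_y)
        - t (nc_subst duflo_fps (ch nc_y nc_x)))"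
      by (simp add: second_order_form_ch)
    also have "t (nc_subst duflo_fps (ch nc_y nc_x)) = t (nc_subst duflo_fps (ch nc_x nc_y))"
      using cyclic[of "nc_exp (- nc_y) * nc_subst duflo_fps (ch nc_y nc_x)" "nc_exp nc_y"]
      by (simp add: ch_conjugate[of nc_y nc_x] nc_subst_conjugate nc_exp_inverse flip: mult.assoc)
    finally have "2 * (2 * t (nc_x * nc_partial VarX A + nc_y * nc_partial VarY B))
        = 2 * (t (nc_subst duflo_fps nc_x) + t (nc_subst duflo_fps nc_y)
        - t (nc_subst duflo_fps (ch nc_x nc_y)))"
      by simp
    then have half: "2 * t (nc_x * nc_partial VarX A + nc_y * nc_partial VarY B)
        = t (nc_subst duflo_fps nc_x) + t (nc_subst duflo_fps nc_y)
        - t (nc_subst duflo_fps (ch nc_x nc_y))"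
      by (simp only: mult_cancel_left) simp
    have "t (nc_x * nc_partial VarX A + nc_y * nc_partial VarY B)
        = 1 / 2 * (2 * t (nc_x * nc_partial VarX A + nc_y * nc_partial VarY B))"
      by simp
    then show "t (nc_x * nc_partial VarX A + nc_y * nc_partial VarY B)
        = t (nc_scale (1 / 2) (nc_subst duflo_fps nc_x + nc_subst duflo_fps nc_y
          - nc_subst duflo_fps (ch nc_x nc_y)))"
      unfolding half by (simp only: scale add diff)
  qed
qed

end
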